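(* Let $x$ be a quadratic irrational number, let $N = \begin{pmatrix} a & b \\ c & d\end{pmatrix} \in \mathbb{Z}^{2,2}$ be a nonsingular integer matrix, let $h_N(x) = \frac{ax+b}{cx+d}$ be the associated M\"obius transformation, and let $n = |\det N|$. Then \[ \frac{1}{S_n} \operatorname{per}(x) \leq \operatorname{per}(h_N(x)) \leq S_n \operatorname{per}(x), \] where \[ S_n = \sum_{\substack{t \in \mathbb{N} \\ t \mid n}} \ \sum_{\substack{j = t\\ j \notin J_t }}^{2t-1} \left(2\left\lfloor \frac{\xi(j,t)}{2} \right\rfloor +1 \right), \qquad J_t = \begin{cases} \emptyset & \text{if } \gcd(t,\tfrac{n}{t}) = 1, \\ \{i \gcd(t,\tfrac{n}{t}) \colon i \in \mathbb{N}\} & \text{otherwise.} \end{cases} \]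
   Context: A quadratic irrational $x$ has an eventually periodic continued fraction expansion $x = [v,\overline{w}]$ with $v \in \mathbb{N}^\ell$, $w \in \mathbb{N}^k$, $k \ge 1$ (the overline denotes infinite repetition of $w$). $\operatorname{per}(x)$ denotes the length of the shortest such $w$, i.e. the least period of the continued fraction expansion of $x$. Since $h_N(x)$ is again a quadratic irrational, $\operatorname{per}(h_N(x))$ is defined likewise. For nonnegative integers $a,c$ not both zero, $\xi(a,c)$ denotes the number of divisions performed by the Euclidean algorithm computing $\gcd(a,c)$ (ending when $0$ is reached); e.g. $\xi(7,0)=\xi(0,7)=0$, $\xi(7,1)=\xi(1,7)=1$, $\xi(13,5)=\xi(5,13)=4$. Here $\mathbb{N}$ includes $0$. *)

theory Defs
  imports Complex_Main
begin

definition quadratic_irrational :: "real \<Rightarrow> bool" where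
  "quadratic_irrational x \<longleftrightarrow> x \<notin> \<rat> \<and>
     (\<exists>p q r :: int. p \<noteq> 0 \<and> of_int p * x\<^sup>2 + of_int q * x + of_int r = 0)"

fun cf_rem :: "real \<Rightarrow> nat \<Rightarrow> real" where
  "cf_rem x 0 = x"
| "cf_rem x (Suc n) = 1 / frac (cf_rem x n)"

definition cf_term :: "real \<Rightarrow> nat \<Rightarrow> int" where
  "cf_term x n = \<lfloor>cf_rem x n\<rfloor>"

definition cf_per :: "real \<Rightarrow> nat" where
  "cf_per x = (LEAST k. k > 0 \<and> (\<exists>l. \<forall>i\<ge>l. cf_term x (i + k) = cf_term x i))"

definition moebius :: "int \<Rightarrow> int \<Rightarrow> int \<Rightarrow> int \<Rightarrow> real \<Rightarrow> real" where
  "moebius a b c d x = (of_int a * x + of_int b) / (of_int c * x + of_int d)"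

text \<open>Number of divisions in the Euclidean algorithm; euc assumes first argument \<ge> second.\<close>
fun euc :: "nat \<Rightarrow> nat \<Rightarrow> nat" where
  "euc a c = (if c = 0 then 0 else Suc (euc c (a mod c)))"

declare euc.simps[simp del]

definition xi :: "nat \<Rightarrow> nat \<Rightarrow> nat" where
  "xi a c = euc (max a c) (min a c)"

definition J_set :: "nat \<Rightarrow> nat \<Rightarrow> nat set" where
  "J_set n t = (if gcd t (n div t) = 1 then {} else {i * gcd t (n div t) | i. True})"

definition S_const :: "nat \<Rightarrow> nat" where
  "S_const n = (\<Sum>t\<in>{t. t dvd n}.
      \<Sum>j\<in>{t..2*t-1} - J_set n t. 2 * (xi j t div 2) + 1)"

lemma "xi 13 5 = 4" "xi 0 7 = 0" "xi 1 7 = 1" "xi 7 0 = 0"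
  by (simp_all add: xi_def euc.simps)

end

theory Submission
  imports Defs "HOL-Computational_Algebra.Primes"
begin

text \<open>
  Write N for the matrix of the transformation, made primitive. Reading one partial quotient a of x
  replaces N by N [[a, 1], [1, 0]], which is brought back to Hermite normal form
  [[n / t, j], [0, t]] by a unimodular matrix, i.e. by the Euclidean algorithm applied to the first
  column. The complete quotients of the transformed number thereby shift by at most the number of
  divisions, made odd. Every partial quotient permutes the finitely many Hermite normal forms.
  Hence, while the period of x is read until the initial normal form returns, each normal form
  occurs at most once at each position of the period, and the total shift, which is a period of the
  transformed number, is at most per(x) times a sum over all normal forms. The lower bound is the
  upper bound for the adjugate matrix.
\<close>

section \<open>Continued fractions with a common tail\<close>

text \<open>The obstacle is sign. The reductions of the first column pass through negative numbers,
  and negating a number makes its expansion longer or shorter by one. Single shifts are therefore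
  controlled from above only, and an accumulated shift of 0 or less would yield no period. Hence
  every comparison of tails carries a second, multiplicative factor; around a closed walk it becomes
  a product of complete quotients of x, which exceeds 1 and forces the accumulated shift to be
  positive. The sum over the normal forms can be smaller than S_n for two reasons. A primitive
  normal form excludes each j that has a prime factor in common with gcd(t, n/t), whereas J_t
  excludes only the multiples of that gcd. Moreover, cancelling a common factor g of the entries
  divides the determinant by g^2, so the sum for n/g^2 has to be compared with the sum for
  n.\<close>

lemma irrational_frac:
  fixes u :: real
  assumes "u \<notin> \<rat>"
  shows "frac u \<notin> \<rat>" "0 < frac u" "frac u < 1"
proof -
  show *: "frac u \<notin> \<rat>"
  proof
    assume "frac u \<in> \<rat>"
    then have "frac u + of_int \<lfloor>u\<rfloor> \<in> \<rat>" by (intro Rats_add) auto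
    then show False using assms by (simp add: frac_def)
  qed
  then show "0 < frac u" using frac_ge_0[of u] by (cases "frac u = 0") auto
  show "frac u < 1" by (rule frac_lt_1)
qed

lemma irrational_inverse: "1 / (u::real) \<notin> \<rat>" if "u \<notin> \<rat>"
proof
  assume "1 / u \<in> \<rat>"
  then have "inverse (1 / u) \<in> \<rat>" by (rule Rats_inverse)
  then show False using that by simp
qed

lemma cf_rem_irrational:
  assumes "u \<notin> \<rat>"
  shows "cf_rem u i \<notin> \<rat>"
  by (induction i) (auto simp: assms intro!: irrational_inverse irrational_frac)

lemma cf_rem_Suc_gt_1:
  assumes "u \<notin> \<rat>"
  shows "1 < cf_rem u (Suc i)"
  using irrational_frac[OF cf_rem_irrational[OF assms, of i]] by (simp add: field_simps)

lemma cf_rem_add: "cf_rem u (m + i) = cf_rem (cf_rem u m) i"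
  by (induction i) auto

lemma cf_rem_step:
  assumes "u \<notin> \<rat>"
  shows "cf_rem u i = of_int (cf_term u i) + 1 / cf_rem u (Suc i)"
  using irrational_frac[OF cf_rem_irrational[OF assms, of i]] by (simp add: cf_term_def frac_def)

text \<open>With v = \<open>cf_rem u m\<close> and q_i the denominators of the convergents of u,
  this product is q_{m-1} v + q_{m-2}, the denominator c v + d in the expression of u as a Moebius
  image of v. Written as a product, it composes without any reference to convergents.\<close>

definition rem_prod :: "real \<Rightarrow> nat \<Rightarrow> real" where
  "rem_prod u m = (\<Prod>i<m. cf_rem u (Suc i))"

lemma rem_prod_0 [simp]: "rem_prod u 0 = 1"
  by (simp add: rem_prod_def)

lemma rem_prod_Suc: "rem_prod u (Suc m) = rem_prod u m * cf_rem u (Suc m)"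
  by (simp add: rem_prod_def)

lemma rem_prod_add: "rem_prod u (m + i) = rem_prod u m * rem_prod (cf_rem u m) i"
proof (induction i)
  case (Suc i)
  have "rem_prod u (m + Suc i) = rem_prod u (m + i) * cf_rem u (m + Suc i)"
    by (simp add: rem_prod_Suc)
  then show ?case using Suc by (simp add: rem_prod_Suc cf_rem_add del: cf_rem.simps add_Suc_right)
qed auto

lemma rem_prod_pos: "u \<notin> \<rat> \<Longrightarrow> 0 < rem_prod u m"
  unfolding rem_prod_def using cf_rem_Suc_gt_1[of u]
  by (intro prod_pos) (metis less_trans zero_less_one)

lemma rem_prod_mono:
  assumes "u \<notin> \<rat>" "m \<le> k"
  shows "rem_prod u m \<le> rem_prod u k"
  using assms(2)
proof (induction k rule: dec_induct)
  case (step k)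
  have "rem_prod u k * 1 \<le> rem_prod u k * cf_rem u (Suc k)"
    using rem_prod_pos[OF assms(1), of k] cf_rem_Suc_gt_1[OF assms(1), of k]
    by (intro mult_left_mono) auto
  then show ?case using step by (simp add: rem_prod_Suc del: cf_rem.simps)
qed auto

text \<open>
  The expansions of u and v have a common tail, reached \<open>\<delta>\<close> steps later in u than in v.
  The factor \<open>\<rho>\<close> is multiplicative along compositions of Moebius transformations, being
  |c v + d| for u = (a v + b) / (c v + d) with determinant 1 or -1. It serves to recognise
  that \<open>\<delta>\<close> is positive when u = v, see \<open>tail_rel_self_imp_period\<close>.
\<close>
definition tail_rel :: "real \<Rightarrow> real \<Rightarrow> int \<Rightarrow> real \<Rightarrow> bool" where
  "tail_rel u v \<delta> \<rho> \<longleftrightarrow> (\<exists>m k. \<delta> = int m - int k \<and> cf_rem u m = cf_rem v k \<and>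
      rem_prod u m = \<rho> * rem_prod v k)"

lemma tail_relI:
  assumes "cf_rem u m = cf_rem v k" "rem_prod u m = \<rho> * rem_prod v k" "\<delta> = int m - int k"
  shows "tail_rel u v \<delta> \<rho>"
  using assms unfolding tail_rel_def by blast

lemma tail_rel_refl: "tail_rel u u 0 1"
  by (rule tail_relI[of _ 0 _ 0]) auto

lemma tail_rel_trans:
  assumes "tail_rel u v \<delta> \<rho>" "tail_rel v w \<delta>' \<rho>'"
  shows "tail_rel u w (\<delta> + \<delta>') (\<rho> * \<rho>')"
proof -
  obtain m k where 1: "\<delta> = int m - int k" "cf_rem u m = cf_rem v k" "rem_prod u m = \<rho> * rem_prod v k"
    using assms(1) unfolding tail_rel_def by blast
  obtain m' k' where 2: "\<delta>' = int m' - int k'" "cf_rem v m' = cf_rem w k'"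
      "rem_prod v m' = \<rho>' * rem_prod w k'"
    using assms(2) unfolding tail_rel_def by blast
  have "cf_rem u (m + m') = cf_rem v (m' + k)"
    by (simp add: cf_rem_add[of u] 1 flip: cf_rem_add[of v]) (simp add: add.commute)
  also have "\<dots> = cf_rem w (k' + k)" by (simp add: cf_rem_add 2)
  finally have *: "cf_rem u (m + m') = cf_rem w (k' + k)" .
  have "rem_prod u (m + m') = \<rho> * rem_prod v (k + m')" by (simp add: rem_prod_add 1)
  also have "\<dots> = \<rho> * rem_prod v (m' + k)" by (simp add: add.commute)
  also have "\<dots> = \<rho> * \<rho>' * rem_prod w (k' + k)" by (simp add: rem_prod_add 2)
  finally show ?thesis by (intro tail_relI[OF *]) (use 1 2 in auto)
qed

lemma tail_rel_sym:
  assumes "tail_rel u v \<delta> \<rho>" "\<rho> \<noteq> 0"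
  shows "tail_rel v u (-\<delta>) (1 / \<rho>)"
proof -
  obtain m k where 1: "\<delta> = int m - int k" "cf_rem u m = cf_rem v k" "rem_prod u m = \<rho> * rem_prod v k"
    using assms(1) unfolding tail_rel_def by blast
  show ?thesis by (rule tail_relI[of _ k _ m]) (use 1 assms(2) in auto)
qed

section \<open>Translation, inversion and negation\<close>

lemma tail_rel_add_int: "tail_rel (u + of_int c) u 0 1"
  by (rule tail_relI[of _ 1 _ 1]) (auto simp: frac_def rem_prod_def)

lemma tail_rel_inverse_gt_1:
  assumes "1 < u"
  shows "tail_rel (1 / u) u 1 u"
proof -
  have "frac (1 / u) = 1 / u" using assms by (simp add: frac_eq)
  then show ?thesis by (intro tail_relI[of _ 1 _ 0]) (auto simp: rem_prod_def)
qed

text \<open>For u > 1 a leading quotient 0 is put in front, for u < 1 it is removed. The exact value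
  in the second case is stated because \<open>euclid_descent\<close> pays for negations with that
  gained step.\<close>

lemma tail_rel_inverse:
  assumes "u \<notin> \<rat>" "0 < u"
  obtains \<delta> where "\<delta> \<le> 1" "u < 1 \<Longrightarrow> \<delta> = -1" "tail_rel (1 / u) u \<delta> u"
proof (cases "u < 1")
  case True
  then have "tail_rel u (1 / u) 1 (1 / u)" using tail_rel_inverse_gt_1[of "1 / u"] assms(2) by simp
  then have "tail_rel (1 / u) u (-1) u" using tail_rel_sym[of u "1 / u" 1 "1 / u"] assms(2) by simp
  then show ?thesis using that[of "-1"] by simp
next
  case False
  moreover have "u \<noteq> 1" using assms(1) by auto
  ultimately show ?thesis using that[of 1] tail_rel_inverse_gt_1[of u] by simp
qed

text \<open>
  In continued fractions: -[b; c, ...] = [-b - 1; 1, c - 1, ...].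
\<close>
lemma tail_rel_uminus_frac_less_half:
  assumes "u \<notin> \<rat>" "frac u < 1 / 2"
  shows "tail_rel (- u) u 1 1"
proof -
  define f where "f = frac u"
  have f: "f \<notin> \<rat>" "0 < f" "f < 1 / 2"
    using irrational_frac[OF assms(1)] assms(2) by (auto simp: f_def)
  have 1: "cf_rem (- u) 1 = 1 / (1 - f)"
    using assms(1) f by (auto simp: frac_neg f_def)
  have "frac (1 / (1 - f)) = f / (1 - f)"
  proof -
    have "\<lfloor>1 / (1 - f)\<rfloor> = 1"
      using f by (intro floor_unique) (auto simp: field_simps)
    then show ?thesis using f by (simp add: frac_def field_simps)
  qed
  moreover have "cf_rem (- u) 2 = 1 / frac (cf_rem (- u) 1)"
    by (simp add: numeral_2_eq_2)
  ultimately have "cf_rem (- u) 2 = 1 / (f / (1 - f))"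
    by (simp only: 1)
  then have 2: "cf_rem (- u) 2 = 1 / f - 1"
    using f by (simp add: field_simps)
  have 3: "cf_rem (- u) 3 = cf_rem u 2"
    using 2 by (simp add: numeral_3_eq_3 numeral_2_eq_2 f_def frac_def)
  have "rem_prod (- u) 3 = cf_rem (- u) 1 * cf_rem (- u) 2 * cf_rem (- u) 3"
    by (simp add: rem_prod_def numeral_3_eq_3 numeral_2_eq_2)
  also have "\<dots> = 1 / (1 - f) * (1 / f - 1) * cf_rem u 2"
    by (simp only: 1 2 3)
  also have "\<dots> = 1 / f * cf_rem u 2"
    using f by (simp add: field_simps)
  also have "\<dots> = rem_prod u 2"
    by (simp add: rem_prod_def numeral_2_eq_2 f_def)
  finally show ?thesis by (intro tail_relI[OF 3]) auto
qed

text \<open>The fractional parts of u and -u add up to 1 and neither is 1/2, so the previous lemma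
  applies to one of the two and symmetry of \<open>tail_rel\<close> gives the other. The shift is 1
  or -1; only the upper bound is passed on.\<close>

lemma tail_rel_uminus:
  assumes "u \<notin> \<rat>"
  obtains \<delta> where "\<delta> \<le> 1" "tail_rel (- u) u \<delta> 1"
proof (cases "frac u < 1 / 2")
  case True
  then show ?thesis using that[of 1] tail_rel_uminus_frac_less_half[OF assms] by simp
next
  case False
  moreover have "frac u \<noteq> 1 / 2"
  proof
    assume "frac u = 1 / 2"
    moreover have "1 / 2 \<in> (\<rat> :: real set)" by (intro Rats_divide) auto
    ultimately have "frac u \<in> \<rat>" by (simp only:)
    then show False using irrational_frac(1)[OF assms] by blast
  qed
  ultimately have "frac (- u) < 1 / 2" using assms by (auto simp: frac_neg)
  then have "tail_rel u (- u) 1 1"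
    using tail_rel_uminus_frac_less_half[of "- u"] assms by simp
  from tail_rel_sym[OF this] show ?thesis using that[of "-1"] by simp
qed

text \<open>\<open>rem_prod\<close> does not decrease with the number of steps, so \<rho> > 1 forces
  m > k in the witnesses of \<open>tail_rel\<close>. The two equal tails thus start at different
  positions of u, and their distance is a period.\<close>

lemma tail_rel_self_imp_period:
  assumes "u \<notin> \<rat>" "tail_rel u u \<delta> \<rho>" "1 < \<rho>"
  shows "0 < \<delta>" "\<exists>l. \<forall>i\<ge>l. cf_term u (i + nat \<delta>) = cf_term u i"
proof -
  obtain m k where 1: "\<delta> = int m - int k" "cf_rem u m = cf_rem u k" "rem_prod u m = \<rho> * rem_prod u k"
    using assms(2) unfolding tail_rel_def by blast
  have "1 * rem_prod u k < \<rho> * rem_prod u k"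
    using rem_prod_pos[OF assms(1), of k] assms(3) by (intro mult_strict_right_mono) auto
  then have "\<not> m \<le> k" using rem_prod_mono[OF assms(1), of m k] 1 by auto
  then show pos: "0 < \<delta>" using 1 by simp
  have "cf_term u (i + nat \<delta>) = cf_term u i" if "i \<ge> k" for i
  proof -
    have i: "i + nat \<delta> = m + (i - k)" "i = k + (i - k)" using 1 that pos by auto
    show ?thesis using 1(2) by (subst i(1), subst (2) i(2)) (simp add: cf_term_def cf_rem_add)
  qed
  then show "\<exists>l. \<forall>i\<ge>l. cf_term u (i + nat \<delta>) = cf_term u i" by blast
qed

lemma irrational_moebius:
  fixes y :: real and s X t Y :: int
  assumes "y \<notin> \<rat>" "s * Y - X * t \<noteq> 0"
  shows "of_int t * y + of_int Y \<noteq> 0"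
    "(of_int s * y + of_int X) / (of_int t * y + of_int Y) \<notin> \<rat>"
proof -
  have lin: "\<alpha> = 0 \<and> \<beta> = 0" if "\<alpha> * y + \<beta> = 0" "\<alpha> \<in> \<rat>" "\<beta> \<in> \<rat>" for \<alpha> \<beta> :: real
  proof (cases "\<alpha> = 0")
    case False
    then have "y = - \<beta> / \<alpha>" using that(1) by (simp add: field_simps)
    then show ?thesis using that assms(1) by auto
  qed (use that in auto)
  show nz: "of_int t * y + of_int Y \<noteq> 0"
    using lin[of "of_int t" "of_int Y"] assms(2) by auto
  define w where "w = (of_int s * y + of_int X) / (of_int t * y + of_int Y)"
  have "w \<notin> \<rat>"
  proof
    assume w: "w \<in> \<rat>"
    have "of_int s * y + of_int X = w * (of_int t * y + of_int Y)"
      using nz by (simp add: w_def)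
    then have "(of_int s - w * of_int t) * y + (of_int X - w * of_int Y) = 0"
      by (simp add: algebra_simps)
    then have "of_int s - w * of_int t = 0 \<and> of_int X - w * of_int Y = 0"
      using w by (intro lin) auto
    then have "of_int s * of_int Y - of_int X * of_int t = (0::real)" by (auto simp: algebra_simps)
    then have "of_int (s * Y - X * t) = (0::real)" by simp
    then show False using assms(2) by (simp only: of_int_eq_0_iff)
  qed
  then show "(of_int s * y + of_int X) / (of_int t * y + of_int Y) \<notin> \<rat>"
    by (simp add: w_def)
qed

section \<open>Row lattices and the Euclidean algorithm\<close>

text \<open>The lattice spanned by the rows of a matrix is unchanged by unimodular left factors.
  Equality of lattices therefore expresses equality up to such a factor, and the factors themselves
  need not be tracked.\<close>

definition rowlat :: "int \<Rightarrow> int \<Rightarrow> int \<Rightarrow> int \<Rightarrow> (int \<times> int) set" where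
  "rowlat s X t Y = {(i * s + j * t, i * X + j * Y) | i j. True}"

lemma rowlatI: "p = i * s + j * t \<Longrightarrow> q = i * X + j * Y \<Longrightarrow> (p, q) \<in> rowlat s X t Y"
  unfolding rowlat_def by blast

lemma rowlat_eqI:
  assumes "(s, X) \<in> rowlat s' X' t' Y'" "(t, Y) \<in> rowlat s' X' t' Y'"
    "(s', X') \<in> rowlat s X t Y" "(t', Y') \<in> rowlat s X t Y"
  shows "rowlat s X t Y = rowlat s' X' t' Y'"
proof -
  have *: "rowlat s X t Y \<subseteq> rowlat s' X' t' Y'"
    if sX: "(s, X) \<in> rowlat s' X' t' Y'" and tY: "(t, Y) \<in> rowlat s' X' t' Y'" for s X t Y s' X' t' Y' :: int
  proof -
    obtain i j where 1: "s = i * s' + j * t'" "X = i * X' + j * Y'"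
      using sX unfolding rowlat_def by blast
    obtain k l where 2: "t = k * s' + l * t'" "Y = k * X' + l * Y'"
      using tY unfolding rowlat_def by blast
    show ?thesis
    proof
      fix z assume "z \<in> rowlat s X t Y"
      then obtain m n where z: "z = (m * s + n * t, m * X + n * Y)"
        unfolding rowlat_def by blast
      show "z \<in> rowlat s' X' t' Y'"
        unfolding z by (rule rowlatI[of _ "m * i + n * k" _ "m * j + n * l"])
          (simp_all add: 1 2 algebra_simps)
    qed
  qed
  show ?thesis using *[OF assms(1,2)] *[OF assms(3,4)] by blast
qed

lemma rowlat_euclid_step: "rowlat s X t Y = rowlat t Y (s - c * t) (X - c * Y)"
  by (intro rowlat_eqI)
    (rule rowlatI[of _ c _ 1] rowlatI[of _ 1 _ 0] rowlatI[of _ 0 _ 1] rowlatI[of _ 1 _ "-c"]; simp)+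

lemma rowlat_add_multiple: "rowlat (s + c * t) (X + c * Y) t Y = rowlat s X t Y"
  by (intro rowlat_eqI)
    (rule rowlatI[of _ 1 _ c] rowlatI[of _ 0 _ 1] rowlatI[of _ 1 _ "-c"]; simp)+

lemma rowlat_uminus: "rowlat s X (- t) (- Y) = rowlat s X t Y"
  by (intro rowlat_eqI)
    (rule rowlatI[of _ 1 _ 0] rowlatI[of _ 0 _ "-1"]; simp)+

lemma rowlat_uminus_first: "rowlat (- s) (- X) t Y = rowlat s X t Y"
  by (intro rowlat_eqI)
    (rule rowlatI[of _ "-1" _ 0] rowlatI[of _ 0 _ "1"]; simp)+

text \<open>Uniqueness of the Hermite normal form: A generates the first coordinates of the lattice,
  D generates the second coordinates of its vectors (0, q), and B is determined modulo D.\<close>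

lemma rowlat_triangular_eqD:
  assumes eq: "rowlat A B 0 D = rowlat A' B' 0 D'" and pos: "0 < A" "0 < D" "0 < A'" "0 < D'"
  shows "A = A'" "D = D'" "D dvd B - B'"
proof -
  have *: "\<exists>i j. A = i * A' \<and> B = i * B' + j * D'" "\<exists>j. D = j * D'"
    if eq: "rowlat A B 0 D = rowlat A' B' 0 D'" and pos: "0 < A'"
    for A B D A' B' D' :: int
  proof -
    have "(A, B) \<in> rowlat A' B' 0 D'" "(0, D) \<in> rowlat A' B' 0 D'"
      unfolding eq[symmetric] by (rule rowlatI[of _ 1 _ 0] rowlatI[of _ 0 _ 1]; simp)+
    then show "\<exists>i j. A = i * A' \<and> B = i * B' + j * D'" "\<exists>j. D = j * D'"
      using pos unfolding rowlat_def by auto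
  qed
  have "A' dvd A" "A dvd A'" using *(1)[OF eq pos(3)] *(1)[OF eq[symmetric] pos(1)] dvd_triv_right by metis+
  then show A: "A = A'" using pos by (simp add: zdvd_antisym_nonneg)
  have "D' dvd D" "D dvd D'" using *(2)[OF eq pos(3)] *(2)[OF eq[symmetric] pos(1)] dvd_triv_right by metis+
  then show D: "D = D'" using pos by (simp add: zdvd_antisym_nonneg)
  obtain i j where ij: "A = i * A'" "B = i * B' + j * D'" using *(1)[OF eq pos(3)] by blast
  then have "i = 1" using A pos by simp
  then show "D dvd B - B'" using ij D by simp
qed

text \<open>
  A rational number has two continued fraction expansions, whose lengths differ by one. If
  the shorter one has length e, these are the odd and the even one of the two lengths.
\<close>
definition euc_odd :: "nat \<Rightarrow> nat" where
  "euc_odd e = 2 * (e div 2) + 1"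

definition euc_even :: "nat \<Rightarrow> nat" where
  "euc_even e = 2 * ((e + 1) div 2)"

text \<open>
  A single Euclidean division s = c t + r turns u = (s y + X) / (t y + Y) into
  u = c + 1 / u' with u' = (t y + Y) / (r y + (X - c Y)), a shift by at most one as long as
  u' > 0. When u' < 0, the tail of -u' is followed instead. The two negations that this costs
  are made up for by the inversion of a number less than 1 at the end of the algorithm.
\<close>
lemma euclid_descent:
  fixes X Y :: int and s t :: nat and y :: real
  defines "u \<equiv> (of_nat s * y + of_int X) / (of_nat t * y + of_int Y)"
  assumes y: "y \<notin> \<rat>" "0 < y" and st: "0 < t" "t \<le> s"
    and sgn: "0 < X \<and> Y \<le> 0 \<or> X \<le> 0 \<and> 0 < Y"
  shows "\<exists>A B D \<delta>. 0 < A \<and> 0 < D \<and> A * D = \<bar>int s * Y - X * int t\<bar> \<and>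
    rowlat (int s) X (int t) Y = rowlat A B 0 D \<and>
    (0 < u \<and> \<delta> \<le> int (if 0 < X then euc_odd (euc s t) else euc_even (euc s t)) \<and>
       tail_rel u ((of_int A * y + of_int B) / of_int D) \<delta> (\<bar>of_nat t * y + of_int Y\<bar> / of_int D) \<or>
     u < 0 \<and> \<delta> \<le> 0 \<and>
       tail_rel (- u) ((of_int A * y + of_int B) / of_int D) \<delta> (\<bar>of_nat t * y + of_int Y\<bar> / of_int D))"
  using st sgn unfolding u_def
proof (induction s t arbitrary: X Y rule: euc.induct)
  case (1 s t)
  define c where "c = int (s div t)"
  define r where "r = s mod t"
  define E where "E = X - c * Y"
  define u where "u = (of_nat s * y + of_int X) / (of_nat t * y + of_int Y)"
  define u' where "u' = (of_nat t * y + of_int Y) / (of_nat r * y + of_int E)"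
  have t: "0 < t" using 1 by simp
  have c: "1 \<le> c" using "1.prems" by (simp add: c_def Suc_leI div_greater_zero_iff)
  have s: "int s = c * int t + int r"
    unfolding c_def r_def by (metis div_mult_mod_eq of_nat_add of_nat_mult)
  then have s': "of_nat s = of_int c * of_nat t + (of_nat r :: real)"
    by (metis of_int_add of_int_mult of_int_of_nat_eq)
  \<comment> \<open>The sign pattern of the second column is exchanged by each division. The
    inequality \<open>- Y \<le> E\<close> serves the last division, where it keeps a negative z
    above -1.\<close>
  have E: "if 0 < X then 0 < E \<and> Y \<le> 0 \<and> - Y \<le> E else E < 0 \<and> 0 < Y"
  proof (cases "0 < X")
    case True
    then have "Y \<le> 0" using "1.prems" by auto
    then have "c * Y \<le> 1 * Y" using c by (intro mult_right_mono_neg) auto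
    then show ?thesis using True \<open>Y \<le> 0\<close> by (auto simp: E_def)
  next
    case False
    then have "0 < Y" "X \<le> 0" using "1.prems" by auto
    then have "1 * Y \<le> c * Y" using c by (intro mult_right_mono) auto
    then have "X < c * Y" using \<open>0 < Y\<close> \<open>X \<le> 0\<close> by linarith
    then show ?thesis using False \<open>0 < Y\<close> by (simp add: E_def)
  qed
  have det: "int s * Y - X * int t = - (int t * E - Y * int r)"
    by (simp add: s E_def algebra_simps)
  have det_nz: "int s * Y - X * int t \<noteq> 0"
  proof (cases "0 < X")
    case True
    then have "0 < X * int t" "int s * Y \<le> 0" using "1.prems" by (auto simp: mult_le_0_iff)
    then show ?thesis by linarith
  next
    case False
    then have "0 < int s * Y" "X * int t \<le> 0" using "1.prems" by (auto simp: mult_le_0_iff)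
    then show ?thesis by linarith
  qed
  have den: "of_nat t * y + of_int Y \<noteq> 0" and u_irr: "u \<notin> \<rat>"
    using irrational_moebius[OF y(1) det_nz] by (auto simp: u_def)
  have u0: "u \<noteq> 0" using u_irr by auto
  have den': "of_nat r * y + of_int E \<noteq> 0" and u'_irr: "u' \<notin> \<rat>"
    using irrational_moebius[OF y(1), of "int t" E Y "int r"] det_nz det by (auto simp: u'_def)
  have u'0: "u' \<noteq> 0" using u'_irr by auto
  have u_eq: "u = of_int c + 1 / u'"
    unfolding u_def u'_def using den den'
    by (simp add: s' E_def field_simps)
  have lat: "rowlat (int s) X (int t) Y = rowlat (int t) Y (int r) E"
    using rowlat_euclid_step[of "int s" X "int t" Y c] by (simp add: s E_def)
  have euc: "euc s t = Suc (euc t r)"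
    using t by (subst euc.simps) (simp add: r_def)
  show ?case
  proof (cases "r = 0")
    case False
    have "\<exists>A B D \<delta>. 0 < A \<and> 0 < D \<and> A * D = \<bar>int t * E - Y * int r\<bar> \<and>
      rowlat (int t) Y (int r) E = rowlat A B 0 D \<and>
      (0 < u' \<and> \<delta> \<le> int (if 0 < Y then euc_odd (euc t r) else euc_even (euc t r)) \<and>
         tail_rel u' ((of_int A * y + of_int B) / of_int D) \<delta> (\<bar>of_nat r * y + of_int E\<bar> / of_int D) \<or>
       u' < 0 \<and> \<delta> \<le> 0 \<and>
         tail_rel (- u') ((of_int A * y + of_int B) / of_int D) \<delta> (\<bar>of_nat r * y + of_int E\<bar> / of_int D))"
      unfolding u'_def r_def
    proof (rule "1.IH")
      show "0 < Y \<and> E \<le> 0 \<or> Y \<le> 0 \<and> 0 < E" using E by (auto split: if_splits)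
    qed (use t False in \<open>auto simp: r_def\<close>)
    then obtain A B D \<delta>' where IH: "0 < A" "0 < D" "A * D = \<bar>int t * E - Y * int r\<bar>"
      "rowlat (int t) Y (int r) E = rowlat A B 0 D"
      "(0 < u' \<and> \<delta>' \<le> int (if 0 < Y then euc_odd (euc t r) else euc_even (euc t r)) \<and>
         tail_rel u' ((of_int A * y + of_int B) / of_int D) \<delta>' (\<bar>of_nat r * y + of_int E\<bar> / of_int D) \<or>
       u' < 0 \<and> \<delta>' \<le> 0 \<and>
         tail_rel (- u') ((of_int A * y + of_int B) / of_int D) \<delta>' (\<bar>of_nat r * y + of_int E\<bar> / of_int D))"
      by blast
    define z where "z = (of_int A * y + of_int B) / of_int D"
    define K' where "K' = (if 0 < Y then euc_odd (euc t r) else euc_even (euc t r))"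
    \<comment> \<open>This ties the parity of the bound to the sign of X: a division exchanges the
      sign pattern and the parity together, and the bound grows by exactly one.\<close>
    have K: "(if 0 < X then euc_odd (euc s t) else euc_even (euc s t)) = Suc K'"
      using E by (auto simp: K'_def euc euc_odd_def euc_even_def split: if_splits)
    have "0 < euc t r" using False by (subst euc.simps) simp
    then have K'_pos: "1 \<le> K'" by (auto simp: K'_def euc_odd_def euc_even_def)
    have \<rho>: "\<bar>u'\<bar> * (\<bar>of_nat r * y + of_int E\<bar> / of_int D) = \<bar>of_nat t * y + of_int Y\<bar> / of_int D"
      unfolding u'_def using den' by (simp add: abs_divide)
    have "\<exists>\<delta>. 0 < u \<and> \<delta> \<le> int (Suc K') \<and> tail_rel u z \<delta> (\<bar>of_nat t * y + of_int Y\<bar> / of_int D) \<or>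
      u < 0 \<and> \<delta> \<le> 0 \<and> tail_rel (- u) z \<delta> (\<bar>of_nat t * y + of_int Y\<bar> / of_int D)"
    proof (cases "0 < u'")
      case True
      then have IH': "\<delta>' \<le> int K'" "tail_rel u' z \<delta>' (\<bar>of_nat r * y + of_int E\<bar> / of_int D)"
        using IH(5) by (auto simp: z_def K'_def)
      obtain \<delta> where \<delta>: "\<delta> \<le> 1" "tail_rel (1 / u') u' \<delta> u'"
        using tail_rel_inverse[OF u'_irr True] by blast
      have "tail_rel u u' \<delta> u'"
        using tail_rel_trans[OF tail_rel_add_int[of "1 / u'" c] \<delta>(2)] by (simp add: u_eq add.commute)
      from tail_rel_trans[OF this IH'(2)]
      have "tail_rel u z (\<delta> + \<delta>') (\<bar>of_nat t * y + of_int Y\<bar> / of_int D)"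
        unfolding \<rho>[symmetric] abs_of_pos[OF True] .
      moreover have "0 < u" using c True by (simp add: u_eq add_pos_pos)
      ultimately show ?thesis using IH'(1) \<delta>(1) by (intro exI[of _ "\<delta> + \<delta>'"]) auto
    next
      case False
      define v where "v = - u'"
      have v: "0 < v" "v \<notin> \<rat>" using False u'0 u'_irr by (auto simp: v_def)
      have IH': "\<delta>' \<le> 0" "tail_rel v z \<delta>' (\<bar>of_nat r * y + of_int E\<bar> / of_int D)"
        using IH(5) False by (auto simp: z_def v_def)
      obtain \<delta> where \<delta>: "\<delta> \<le> 1" "v < 1 \<Longrightarrow> \<delta> = -1" "tail_rel (1 / v) v \<delta> v"
        using tail_rel_inverse[OF v(2,1)] by blast
      have inv: "tail_rel (1 / v) z (\<delta> + \<delta>') (\<bar>of_nat t * y + of_int Y\<bar> / of_int D)"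
        using tail_rel_trans[OF \<delta>(3) IH'(2)] False unfolding \<rho>[symmetric] by (simp add: v_def)
      have u: "u = of_int c - 1 / v" by (simp add: u_eq v_def)
      show ?thesis
      proof (cases "0 < u")
        case True
        \<comment> \<open>The negation and the inversion may cost one step each. The sum stays
          within the bound since \<delta>' is at most 0 and \<open>Suc K'\<close> is at least
          2.\<close>
        obtain \<epsilon> where \<epsilon>: "\<epsilon> \<le> 1" "tail_rel (- (1 / v)) (1 / v) \<epsilon> 1"
          using tail_rel_uminus[OF irrational_inverse[OF v(2)]] by blast
        have "tail_rel u (1 / v) \<epsilon> 1"
          using tail_rel_trans[OF tail_rel_add_int[of "- (1 / v)" c] \<epsilon>(2)] by (simp add: u)
        from tail_rel_trans[OF this inv] show ?thesis
          using True \<epsilon>(1) \<delta>(1) IH'(1) K'_pos by (intro exI[of _ "\<epsilon> + (\<delta> + \<delta>')"]) auto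
      next
        case False
        then have "u < 0" using u0 by simp
        \<comment> \<open>Here the quotient c must be at least 1: u < 0 then makes 1 / v exceed 1,
          so the inversion saves a step, and no negation is spent because -u is followed.\<close>
        then have "1 < 1 / v" using u c by linarith
        then have "v < 1" using v by (simp add: field_simps)
        have "tail_rel (- u) z (\<delta> + \<delta>') (\<bar>of_nat t * y + of_int Y\<bar> / of_int D)"
          using tail_rel_trans[OF tail_rel_add_int[of "1 / v" "- c"] inv] by (simp add: u)
        then show ?thesis
          using \<open>u < 0\<close> \<delta>(2)[OF \<open>v < 1\<close>] IH'(1) by (intro exI[of _ "\<delta> + \<delta>'"]) auto
      qed
    qed
    then show ?thesis
      unfolding lat K u_def[symmetric] IH(4) det abs_minus_cancel IH(3)[symmetric]
      using IH(1,2) by - (rule exI[of _ A], rule exI[of _ B], rule exI[of _ D], simp add: z_def)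
  next
    case True
    define D where "D = \<bar>E\<bar>"
    have D: "0 < D" using E by (auto simp: D_def split: if_splits)
    define z where "z = (of_int (int t) * y + of_int Y) / of_int D"
    have lat': "rowlat (int s) X (int t) Y = rowlat (int t) Y 0 D"
      unfolding lat D_def True using rowlat_uminus[of "int t" Y 0 E] by (auto simp: abs_if)
    have z_irr: "z \<notin> \<rat>"
      using irrational_moebius(2)[OF y(1), of "int t" D Y 0] t D by (simp add: z_def)
    then have z0: "z \<noteq> 0" by auto
    have euc1: "euc s t = 1" using euc True by (simp add: euc.simps)
    have absz: "\<bar>z\<bar> = \<bar>of_nat t * y + of_int Y\<bar> / of_int D"
      using D by (simp add: z_def abs_divide)
    have "\<exists>\<delta>. 0 < u \<and> \<delta> \<le> int (if 0 < X then 1 else 2) \<and> tail_rel u z \<delta> \<bar>z\<bar> \<or>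
        u < 0 \<and> \<delta> \<le> 0 \<and> tail_rel (- u) z \<delta> \<bar>z\<bar>"
    proof (cases "0 < z \<and> 0 < X")
      case zX: True
      then have "u' = z" using E True by (simp add: u'_def z_def D_def)
      obtain \<delta> where \<delta>: "\<delta> \<le> 1" "tail_rel (1 / z) z \<delta> z"
        using tail_rel_inverse[OF z_irr] zX by blast
      have "tail_rel u z \<delta> z"
        using tail_rel_trans[OF tail_rel_add_int[of "1 / z" c] \<delta>(2)] \<open>u' = z\<close>
        by (simp add: u_eq add.commute)
      moreover have "0 < u" using c zX \<open>u' = z\<close> by (simp add: u_eq add_pos_pos)
      ultimately show ?thesis using zX \<delta> by (intro exI[of _ \<delta>]) auto
    next
      case zX: False
      define v where "v = \<bar>z\<bar>"
      have v: "0 < v" "v \<notin> \<rat>" using z0 z_irr by (auto simp: v_def abs_if)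
      have u: "u = of_int c - 1 / v"
      proof (cases "0 < X")
        case True
        then have "u' = z" using E \<open>r = 0\<close> by (auto simp: u'_def z_def D_def)
        moreover have "z < 0" using True zX z0 by auto
        ultimately show ?thesis by (simp add: u_eq v_def)
      next
        case False
        then have "u' = - z" using E True by (auto simp: u'_def z_def D_def)
        moreover have "0 < of_nat t * y + of_int Y" using False E t y by (auto intro: add_pos_pos)
        then have "0 < z" using D by (simp add: z_def)
        ultimately show ?thesis by (simp add: u_eq v_def)
      qed
      obtain \<delta> where \<delta>: "\<delta> \<le> 1" "v < 1 \<Longrightarrow> \<delta> = -1" "tail_rel (1 / v) v \<delta> v"
        using tail_rel_inverse[OF v(2,1)] by blast
      \<comment> \<open>If 0 < X, then z is negative and a negation is spent, but |z| < 1 makes the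
        inversion save a step in return. Otherwise z is positive and v is z itself.\<close>
      have "\<exists>\<epsilon>. tail_rel v z \<epsilon> 1 \<and> \<epsilon> \<le> 1 \<and> (if 0 < X then v < 1 else \<epsilon> = 0)"
      proof (cases "0 < X")
        case True
        then have "z < 0" using zX z0 by auto
        have "of_int (- Y) \<le> (of_int D :: real)" using True E by (subst of_int_le_iff) (auto simp: D_def)
        then have "- (of_nat t * y + of_int Y) < of_int D" using t y by (smt (verit) mult_pos_pos of_int_minus of_nat_0_less_iff)
        then have "- z < 1" using D by (simp add: z_def field_simps)
        then have "v < 1" using \<open>z < 0\<close> by (simp add: v_def)
        obtain \<epsilon> where "\<epsilon> \<le> 1" "tail_rel (- z) z \<epsilon> 1" using tail_rel_uminus[OF z_irr] by blast
        then show ?thesis using True \<open>v < 1\<close> \<open>z < 0\<close> by (auto simp: v_def)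
      next
        case False
        moreover have "0 < of_nat t * y + of_int Y" using False E t y by (auto intro: add_pos_pos)
        then have "0 < z" using D by (simp add: z_def)
        ultimately show ?thesis using tail_rel_refl[of z] by (auto simp: v_def)
      qed
      then obtain \<epsilon> where \<epsilon>: "tail_rel v z \<epsilon> 1" "\<epsilon> \<le> 1" "if 0 < X then v < 1 else \<epsilon> = 0"
        by blast
      have inv: "tail_rel (1 / v) z (\<delta> + \<epsilon>) v"
        using tail_rel_trans[OF \<delta>(3) \<epsilon>(1)] by simp
      show ?thesis
      proof (cases "0 < u")
        case True
        obtain \<eta> where \<eta>: "\<eta> \<le> 1" "tail_rel (- (1 / v)) (1 / v) \<eta> 1"
          using tail_rel_uminus[OF irrational_inverse[OF v(2)]] by blast
        have "tail_rel u (1 / v) \<eta> 1"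
          using tail_rel_trans[OF tail_rel_add_int[of "- (1 / v)" c] \<eta>(2)] by (simp add: u)
        from tail_rel_trans[OF this inv] have "tail_rel u z (\<eta> + (\<delta> + \<epsilon>)) v" by simp
        moreover have "\<eta> + (\<delta> + \<epsilon>) \<le> int (if 0 < X then 1 else 2)"
          using \<eta> \<delta>(1,2) \<epsilon>(2,3) by (auto split: if_splits)
        ultimately show ?thesis using True unfolding v_def by blast
      next
        case False
        then have "u < 0" using u0 by simp
        then have "1 < 1 / v" using u c by linarith
        then have "v < 1" using v by (simp add: field_simps)
        have "tail_rel (- u) z (\<delta> + \<epsilon>) v"
          using tail_rel_trans[OF tail_rel_add_int[of "1 / v" "- c"] inv] by (simp add: u)
        moreover have "\<delta> + \<epsilon> \<le> 0" using \<delta>(2)[OF \<open>v < 1\<close>] \<epsilon>(2) by simp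
        ultimately show ?thesis using \<open>u < 0\<close> unfolding v_def by blast
      qed
    qed
    moreover have "int t * D = \<bar>int s * Y - X * int t\<bar>"
      unfolding det D_def True by (simp add: abs_mult)
    moreover have "(if 0 < X then euc_odd (euc s t) else euc_even (euc s t)) = (if 0 < X then 1 else 2)"
      by (simp add: euc1 euc_odd_def euc_even_def)
    ultimately show ?thesis
      unfolding u_def[symmetric] absz lat'
      using D t by - (rule exI[of _ "int t"], rule exI[of _ Y], rule exI[of _ D], simp add: z_def)
  qed
qed

section \<open>Reduction of an arbitrary matrix\<close>

lemma tail_rel_inverse_abs:
  assumes "u \<notin> \<rat>"
  shows "\<exists>\<delta>. tail_rel (1 / u) u \<delta> \<bar>u\<bar>"
proof (cases "0 < u")
  case True
  then show ?thesis using tail_rel_inverse[OF assms True] by (metis abs_of_pos)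
next
  case False
  define v where "v = - u"
  have v: "v \<notin> \<rat>" "0 < v" using assms False by (auto simp: v_def) (metis Rats_0 less_eq_real_def not_less)
  obtain \<delta> where 1: "tail_rel (1 / v) v \<delta> v" using tail_rel_inverse[OF v] by blast
  obtain \<epsilon> where 2: "tail_rel (- (1 / v)) (1 / v) \<epsilon> 1"
    using tail_rel_uminus[OF irrational_inverse[OF v(1)]] by blast
  obtain \<eta> where 3: "tail_rel v u \<eta> 1"
    using tail_rel_uminus[OF assms] by (metis v_def)
  have "tail_rel (- (1 / v)) u (\<epsilon> + (\<delta> + \<eta>)) v"
    using tail_rel_trans[OF 2 tail_rel_trans[OF 1 3]] by simp
  moreover have "- (1 / v) = 1 / u" "v = \<bar>u\<bar>" using False by (auto simp: v_def)
  ultimately show ?thesis by auto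
qed

text \<open>The Euclidean algorithm with entries of any sign and no count of its steps. It is
  applied once, before the walk starts, and its shift and factor cancel when the walk closes, so any
  \<delta> and any positive \<rho> will do.\<close>

lemma moebius_tail_rel_triangular:
  fixes s X t Y :: int
  assumes y: "y \<notin> \<rat>" and det: "s * Y - X * t \<noteq> 0"
  shows "\<exists>A B D \<delta> \<rho>. 0 < A \<and> 0 < D \<and> A * D = \<bar>s * Y - X * t\<bar> \<and>
    rowlat s X t Y = rowlat A B 0 D \<and> 0 < \<rho> \<and>
    tail_rel ((of_int s * y + of_int X) / (of_int t * y + of_int Y))
      ((of_int A * y + of_int B) / of_int D) \<delta> \<rho>"
  using det
proof (induction "nat \<bar>t\<bar>" arbitrary: s X t Y rule: less_induct)
  case less
  define u where "u = (of_int s * y + of_int X) / (of_int t * y + of_int Y)"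
  have u: "u \<notin> \<rat>" and den: "of_int t * y + of_int Y \<noteq> 0"
    using irrational_moebius[OF y less.prems] by (auto simp: u_def)
  show ?case
  proof (cases "t = 0")
    case True
    have nz: "s \<noteq> 0" "Y \<noteq> 0" using less.prems True by auto
    define z where "z = (of_int \<bar>s\<bar> * y + of_int (sgn s * X)) / of_int \<bar>Y\<bar>"
    have "rowlat s X t Y = rowlat \<bar>s\<bar> (sgn s * X) 0 \<bar>Y\<bar>"
      using rowlat_uminus[of s X 0 Y] rowlat_uminus_first[of s X 0 Y]
        rowlat_uminus_first[of s X 0 "-Y"] True nz
      by (auto simp: abs_if sgn_if)
    moreover have "z = u \<or> z = - u"
      using nz True by (auto simp: z_def u_def abs_if sgn_if field_simps)
    then have "\<exists>\<delta>. tail_rel u z \<delta> 1"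
    proof
      assume "z = - u"
      then have "- z = u" by simp
      moreover have "z \<notin> \<rat>" using u \<open>z = - u\<close> by simp
      ultimately show ?thesis using tail_rel_uminus[of z] by metis
    qed (use tail_rel_refl in auto)
    ultimately show ?thesis unfolding u_def[symmetric]
      using nz True
      by - (rule exI[of _ "\<bar>s\<bar>"], rule exI[of _ "sgn s * X"], rule exI[of _ "\<bar>Y\<bar>"],
        auto simp: abs_mult z_def intro!: exI[of _ "1::real"])
  next
    case False
    define c where "c = s div t"
    define r where "r = s mod t"
    define E where "E = X - c * Y"
    define u' where "u' = (of_int t * y + of_int Y) / (of_int r * y + of_int E)"
    have s: "s = c * t + r" by (simp add: c_def r_def)
    have "nat \<bar>r\<bar> < nat \<bar>t\<bar>"
      using False abs_mod_less[of t s] by (simp add: r_def)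
    moreover have det: "s * Y - X * t = - (t * E - Y * r)" by (simp add: s E_def algebra_simps)
    ultimately obtain A B D \<delta> \<rho> where IH: "0 < A" "0 < D" "A * D = \<bar>t * E - Y * r\<bar>"
      "rowlat t Y r E = rowlat A B 0 D" "0 < \<rho>"
      "tail_rel u' ((of_int A * y + of_int B) / of_int D) \<delta> \<rho>"
      using less.hyps[of r t E Y] less.prems unfolding u'_def by auto
    have den': "of_int r * y + of_int E \<noteq> 0" and u': "u' \<notin> \<rat>"
      using irrational_moebius[OF y, of t E Y r] det less.prems by (auto simp: u'_def)
    have "u' \<noteq> 0" using u' by auto
    obtain \<epsilon> where "tail_rel (1 / u') u' \<epsilon> \<bar>u'\<bar>" using tail_rel_inverse_abs[OF u'] by blast
    from tail_rel_trans[OF tail_rel_add_int[of _ c] tail_rel_trans[OF this IH(6)]]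
    have "tail_rel (1 / u' + of_int c) ((of_int A * y + of_int B) / of_int D) (\<epsilon> + \<delta>) (\<bar>u'\<bar> * \<rho>)"
      by simp
    moreover have "1 / u' + of_int c = u"
      unfolding u_def u'_def using den den' by (simp add: s E_def field_simps)
    moreover have "rowlat s X t Y = rowlat A B 0 D"
      using rowlat_euclid_step[of s X t Y c] IH(4) by (simp add: s E_def)
    moreover have "0 < \<bar>u'\<bar> * \<rho>" using \<open>u' \<noteq> 0\<close> IH(5) by simp
    moreover have "A * D = \<bar>s * Y - X * t\<bar>" using IH(3) by (simp only: det abs_minus_cancel)
    ultimately show ?thesis unfolding u_def[symmetric] using IH(1,2) by blast
  qed
qed

text \<open>A property of the lattice instead of the four entries, so that it carries over along
  equalities of row lattices.\<close>

definition primitive_lat :: "(int \<times> int) set \<Rightarrow> bool" where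
  "primitive_lat \<Lambda> \<longleftrightarrow> (\<forall>d. (\<forall>(p, q)\<in>\<Lambda>. d dvd p \<and> d dvd q) \<longrightarrow> is_unit d)"

lemma primitive_lat_rowlat_iff:
  "primitive_lat (rowlat s X t Y) \<longleftrightarrow>
     (\<forall>d. d dvd s \<and> d dvd X \<and> d dvd t \<and> d dvd Y \<longrightarrow> is_unit d)"
proof -
  have "(\<forall>(p, q)\<in>rowlat s X t Y. d dvd p \<and> d dvd q) \<longleftrightarrow> d dvd s \<and> d dvd X \<and> d dvd t \<and> d dvd Y"
    (is "?L \<longleftrightarrow> ?R") for d
  proof
    assume ?L
    moreover have "(s, X) \<in> rowlat s X t Y" "(t, Y) \<in> rowlat s X t Y"
      by (rule rowlatI[of _ 1 _ 0] rowlatI[of _ 0 _ 1]; simp)+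
    ultimately show ?R by blast
  qed (auto simp: rowlat_def)
  then show ?thesis by (simp only: primitive_lat_def)
qed

text \<open>Right multiplication of a row vector by [[a, 1], [1, 0]]. It commutes with row
  operations and hence acts on lattices, injectively since the matrix is invertible.\<close>

definition digit_map :: "int \<Rightarrow> int \<times> int \<Rightarrow> int \<times> int" where
  "digit_map a = (\<lambda>(p, q). (a * p + q, p))"

lemma inj_digit_map: "inj (digit_map a)"
  by (auto simp: inj_def digit_map_def)

lemma digit_map_rowlat: "digit_map a ` rowlat s X t Y = rowlat (a * s + X) s (a * t + Y) t"
proof
  show "digit_map a ` rowlat s X t Y \<subseteq> rowlat (a * s + X) s (a * t + Y) t"
    unfolding rowlat_def digit_map_def by (auto simp: algebra_simps) (metis add.assoc)
  show "rowlat (a * s + X) s (a * t + Y) t \<subseteq> digit_map a ` rowlat s X t Y"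
  proof
    fix z assume "z \<in> rowlat (a * s + X) s (a * t + Y) t"
    then obtain i j where "z = (i * (a * s + X) + j * (a * t + Y), i * s + j * t)"
      unfolding rowlat_def by blast
    then have "z = digit_map a (i * s + j * t, i * X + j * Y)"
      by (simp add: digit_map_def algebra_simps)
    then show "z \<in> digit_map a ` rowlat s X t Y"
      unfolding rowlat_def by blast
  qed
qed

lemma primitive_lat_digit_map:
  assumes "primitive_lat (rowlat s X t Y)"
  shows "primitive_lat (digit_map a ` rowlat s X t Y)"
  unfolding digit_map_rowlat primitive_lat_rowlat_iff
proof (intro allI impI)
  fix d assume d: "d dvd a * s + X \<and> d dvd s \<and> d dvd a * t + Y \<and> d dvd t"
  then have "d dvd X" "d dvd Y" by (metis dvd_add_right_iff dvd_mult)+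
  then show "is_unit d" using d assms unfolding primitive_lat_rowlat_iff by blast
qed

section \<open>Hermite normal forms\<close>

text \<open>
  The pair (t, j) stands for the matrix with rows (n / t, j) and (0, t). Up to the choice of
  representatives j modulo t these are the Hermite normal forms of the primitive integer
  matrices of determinant n or -n, i.e. the orbits of such matrices under left multiplication
  by unimodular matrices.
\<close>
definition states :: "nat \<Rightarrow> (nat \<times> nat) set" where
  "states n = {(t, j). t dvd n \<and> t \<le> j \<and> j < 2 * t \<and> gcd (gcd t (n div t)) j = 1}"

definition state_lat :: "nat \<Rightarrow> nat \<times> nat \<Rightarrow> (int \<times> int) set" where
  "state_lat n \<sigma> = rowlat (int (n div fst \<sigma>)) (int (snd \<sigma>)) 0 (int (fst \<sigma>))"

definition state_val :: "nat \<Rightarrow> nat \<times> nat \<Rightarrow> real \<Rightarrow> real" where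
  "state_val n \<sigma> y = (of_nat (n div fst \<sigma>) * y + of_nat (snd \<sigma>)) / of_nat (fst \<sigma>)"

lemma finite_states:
  assumes "0 < n"
  shows "finite (states n)"
proof (rule finite_subset)
  show "states n \<subseteq> {..n} \<times> {..2 * n}"
    using assms by (auto simp: states_def dest: dvd_imp_le)
qed auto

lemma states_bounds:
  assumes "(t, j) \<in> states n" "0 < n"
  shows "0 < t" "t dvd n" "t \<le> j" "j < 2 * t" "0 < n div t" "n div t * t = n"
  using assms by (auto simp: states_def div_greater_zero_iff dvd_imp_le dvd_pos_nat)

lemma primitive_state_lat_iff:
  "primitive_lat (rowlat (int A) (int j) 0 (int t)) \<longleftrightarrow> gcd (gcd t A) j = 1"
proof
  assume "primitive_lat (rowlat (int A) (int j) 0 (int t))"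
  then have "is_unit (int (gcd (gcd t A) j))"
    unfolding primitive_lat_rowlat_iff by (meson dvd_0_right dvd_trans gcd_dvd1 gcd_dvd2 int_dvd_int_iff)
  then show "gcd (gcd t A) j = 1" by simp
next
  assume 1: "gcd (gcd t A) j = 1"
  show "primitive_lat (rowlat (int A) (int j) 0 (int t))"
    unfolding primitive_lat_rowlat_iff
  proof (intro allI impI)
    fix d assume "d dvd int A \<and> d dvd int j \<and> d dvd 0 \<and> d dvd int t"
    then have "nat \<bar>d\<bar> dvd gcd (gcd t A) j" by (simp add: nat_abs_dvd_iff)
    then show "is_unit d" using 1 by (simp add: nat_abs_dvd_iff)
  qed
qed

lemma eq_if_dvd_diff_of_bounds:
  fixes t i j :: nat
  assumes "int t dvd int i - int j" "t \<le> i" "i < 2 * t" "t \<le> j" "j < 2 * t"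
  shows "i = j"
proof -
  have "\<bar>int i - int j\<bar> < int t" using assms by linarith
  then have "int i - int j = 0" using assms(1) zdvd_not_zless[of "\<bar>int i - int j\<bar>" "int t"]
    by (metis abs_ge_zero abs_eq_0 dvd_abs_iff less_le)
  then show ?thesis by simp
qed

lemma state_lat_inj:
  assumes "\<sigma> \<in> states n" "\<tau> \<in> states n" "0 < n" "state_lat n \<sigma> = state_lat n \<tau>"
  shows "\<sigma> = \<tau>"
proof -
  obtain t j t' j' where \<sigma>: "\<sigma> = (t, j)" "\<tau> = (t', j')" by (metis surj_pair)
  note b = states_bounds[OF assms(1)[unfolded \<sigma>] assms(3)] states_bounds[OF assms(2)[unfolded \<sigma>] assms(3)]
  have eq: "rowlat (int (n div t)) (int j) 0 (int t) = rowlat (int (n div t')) (int j') 0 (int t')"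
    using assms(4) by (simp add: state_lat_def \<sigma>)
  have "int t = int t'" "int t dvd int j - int j'"
    using rowlat_triangular_eqD(2,3)[OF eq] b by auto
  then show ?thesis using eq_if_dvd_diff_of_bounds[of t j j'] b \<sigma> by simp
qed

lemma triangular_to_state:
  assumes "0 < A" "0 < D" "A * D = int n" "primitive_lat (rowlat A B 0 D)"
  shows "\<exists>\<sigma>\<in>states n. state_lat n \<sigma> = rowlat A B 0 D \<and> int (fst \<sigma>) = D \<and>
    (\<forall>y. tail_rel ((of_int A * y + of_int B) / of_int D) (state_val n \<sigma> y) 0 1)"
proof -
  define t where "t = nat D"
  define j where "j = t + nat (B mod D)"
  \<comment> \<open>The \<open>- 1\<close> comes from choosing j between t and 2 t - 1, where the
    first division of j by t has a positive quotient. The change of representative is a translation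
    by an integer and costs no shift.\<close>
  define c where "c = B div D - 1"
  have D: "D = int t" "0 < t" using assms by (auto simp: t_def)
  have A: "A = int (n div t)"
    using assms(3) D by (metis nonzero_mult_div_cancel_right of_nat_eq_0_iff zdiv_int less_irrefl_nat)
  have j: "t \<le> j" "j < 2 * t" using D by (auto simp: j_def nat_less_iff)
  have "int j = D + B mod D" using D by (simp add: j_def)
  then have B: "B = int j + c * D" by (simp add: c_def algebra_simps)
  have lat: "rowlat A B 0 D = rowlat A (int j) 0 D"
    using rowlat_add_multiple[of A c 0 "int j" D] by (simp add: B)
  have "t dvd n" using assms(3) D by (metis dvd_triv_right int_dvd_int_iff)
  moreover have "gcd (gcd t (n div t)) j = 1"
    using assms(4) by (simp add: lat) (simp add: A D(1) primitive_state_lat_iff)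
  ultimately have "(t, j) \<in> states n" using j by (simp add: states_def)
  moreover have "(of_int A * y + of_int B) / of_int D = state_val n (t, j) y + of_int c" for y
    using D by (simp add: state_val_def A B field_simps)
  ultimately show ?thesis using lat D A
    by (intro bexI[of _ "(t, j)"]) (auto simp: state_lat_def tail_rel_add_int)
qed

text \<open>Not the next state: this is the first column (n/t * a + j, t) that appears after a is
  read, its first entry moved between t and 2 t - 1. Its Euclidean algorithm measures the cost of
  the step, while the next state is the result of that algorithm.\<close>

definition read_digit :: "nat \<Rightarrow> int \<Rightarrow> nat \<times> nat \<Rightarrow> nat \<times> nat" where
  "read_digit n a = (\<lambda>(t, j). (t, t + nat ((int (n div t) * a + int j) mod int t)))"

text \<open>Reading a turns the normal form into the rows (A a + j, A) and (t, 0) with A = n / t,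
  and an integer translation replaces A a + j by k. The second column (A, 0) falls under the case 0
  < X of \<open>euclid_descent\<close> and the value u is positive, which selects the odd bound;
  this is the origin of the odd summands of S_n.\<close>

lemma state_transition:
  assumes \<sigma>: "\<sigma> \<in> states n" and n: "0 < n" and y: "y \<notin> \<rat>" "0 < y"
  shows "\<exists>\<tau>\<in>states n. state_lat n \<tau> = digit_map a ` state_lat n \<sigma> \<and>
    (\<exists>\<delta>. \<delta> \<le> int (euc_odd (euc (snd (read_digit n a \<sigma>)) (fst (read_digit n a \<sigma>)))) \<and>
      tail_rel (state_val n \<sigma> (of_int a + 1 / y)) (state_val n \<tau> y) \<delta> (y * of_nat (fst \<sigma>) / of_nat (fst \<tau>)))"
proof -
  obtain t j where tj: "\<sigma> = (t, j)" by (metis surj_pair)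
  note b = states_bounds[OF \<sigma>[unfolded tj] n]
  define A where "A = n div t"
  define s where "s = int A * a + int j"
  define k where "k = t + nat (s mod int t)"
  define c where "c = s div int t - 1"
  have rd: "read_digit n a \<sigma> = (t, k)" by (simp add: read_digit_def tj k_def s_def A_def)
  have k: "t \<le> k" by (simp add: k_def)
  have "int k = int t + s mod int t" using b by (simp add: k_def)
  then have s: "s = int k + c * int t" by (simp add: c_def algebra_simps)
  have "real_of_int s = real_of_int (int k + c * int t)" by (simp only: s)
  then have s': "real A * of_int a + real j = real k + of_int c * real t" by (simp add: s_def)
  define u where "u = (of_nat k * y + of_int (int A)) / (of_nat t * y + of_int 0)"
  have u: "0 < u" using b y k by (auto simp: u_def A_def intro!: divide_pos_pos add_nonneg_pos)
  have "0 < int A" using b by (simp add: A_def)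
  then obtain A' B D \<delta> where *: "0 < A'" "0 < D" "A' * D = \<bar>int k * 0 - int A * int t\<bar>"
    "rowlat (int k) (int A) (int t) 0 = rowlat A' B 0 D"
    "\<delta> \<le> int (euc_odd (euc k t))"
    "tail_rel u ((of_int A' * y + of_int B) / of_int D) \<delta> (\<bar>of_nat t * y + of_int 0\<bar> / of_int D)"
    using euclid_descent[OF y b(1) k, of "int A" 0] u unfolding u_def by fastforce
  have lat: "digit_map a ` state_lat n \<sigma> = rowlat A' B 0 D"
    using rowlat_add_multiple[of "int k" c "int t" "int A" 0] *(4) s
    by (simp add: tj state_lat_def digit_map_rowlat A_def s_def mult.commute)
  have "primitive_lat (state_lat n \<sigma>)"
    using \<sigma> by (simp add: tj state_lat_def primitive_state_lat_iff states_def)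
  then have prim: "primitive_lat (rowlat A' B 0 D)"
    unfolding lat[symmetric] state_lat_def by (rule primitive_lat_digit_map)
  have "A' * D = int n" using *(3) b(6) by (simp add: A_def flip: of_nat_mult)
  from triangular_to_state[OF *(1,2) this prim] obtain \<tau> where \<tau>: "\<tau> \<in> states n"
    "state_lat n \<tau> = rowlat A' B 0 D" "int (fst \<tau>) = D"
    "tail_rel ((of_int A' * y + of_int B) / of_int D) (state_val n \<tau> y) 0 1" by blast
  have "state_val n \<sigma> (of_int a + 1 / y) = u + of_int c"
  proof -
    have "state_val n \<sigma> (of_int a + 1 / y) = ((real A * of_int a + real j) + real A / y) / real t"
      by (simp add: state_val_def tj A_def algebra_simps)
    also have "\<dots> = u + of_int c"
      unfolding s' u_def using b y by (simp add: field_simps)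
    finally show ?thesis .
  qed
  moreover have "tail_rel (u + of_int c) (state_val n \<tau> y) \<delta> (\<bar>of_nat t * y + of_int 0\<bar> / of_int D)"
    using tail_rel_trans[OF tail_rel_add_int tail_rel_trans[OF *(6) \<tau>(4)]] by simp
  moreover have "\<bar>of_nat t * y + of_int 0\<bar> / of_int D = y * of_nat (fst \<sigma>) / of_nat (fst \<tau>)"
    using y b tj \<tau>(3) by (metis abs_mult abs_of_nat abs_of_pos add.right_neutral fst_conv mult.commute of_int_0 of_int_of_nat_eq)
  ultimately show ?thesis using \<tau> lat *(5) rd by (intro bexI[of _ \<tau>]) auto
qed

definition state_sum :: "nat \<Rightarrow> nat" where
  "state_sum n = (\<Sum>(t, j)\<in>states n. euc_odd (euc j t))"

lemma read_digit_in_states: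
  assumes "\<sigma> \<in> states n" "0 < n"
  shows "read_digit n a \<sigma> \<in> states n"
proof -
  obtain t j where tj: "\<sigma> = (t, j)" by (metis surj_pair)
  note b = states_bounds[OF assms(1)[unfolded tj] assms(2)]
  define A where "A = n div t"
  define k where "k = t + nat ((int A * a + int j) mod int t)"
  have k: "read_digit n a \<sigma> = (t, k)" "t \<le> k" "k < 2 * t"
    using b by (auto simp: read_digit_def tj k_def A_def nat_less_iff)
  have *: "d dvd 1" if d: "d dvd t" "d dvd A" "d dvd k" for d
  proof -
    have "int k = int t + (int A * a + int j) mod int t" using b by (simp add: k_def)
    then have "(int A * a + int j) mod int t = int k - int t" by simp
    then have "int d dvd (int A * a + int j) mod int t" using d by simp
    then have "int d dvd int A * a + int j" using d by (simp add: dvd_mod_iff)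
    then have "int d dvd int j" using d(2) by (metis dvd_add_right_iff dvd_mult2 int_dvd_int_iff)
    then have "d dvd gcd (gcd t A) j" using d by simp
    moreover have "gcd (gcd t A) j = 1" using assms(1) by (simp add: states_def tj A_def)
    ultimately show ?thesis by (simp only:)
  qed
  have "gcd (gcd t A) k dvd 1"
    by (rule *) (meson dvd_trans gcd_dvd1 gcd_dvd2)+
  then have "gcd (gcd t A) k = 1" by simp
  then show ?thesis using k b by (simp add: states_def A_def)
qed

lemma read_digit_inj_on:
  assumes "0 < n"
  shows "inj_on (read_digit n a) (states n)"
proof (rule inj_onI)
  fix \<sigma> \<tau> assume st: "\<sigma> \<in> states n" "\<tau> \<in> states n" and eq: "read_digit n a \<sigma> = read_digit n a \<tau>"
  obtain t j t' j' where tj: "\<sigma> = (t, j)" "\<tau> = (t', j')" by (metis surj_pair)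
  note b = states_bounds[OF st(1)[unfolded tj] assms] states_bounds[OF st(2)[unfolded tj] assms]
  have t: "t' = t" using eq by (simp add: read_digit_def tj)
  then have "(int (n div t) * a + int j) mod int t = (int (n div t) * a + int j') mod int t"
    using eq b by (auto simp: read_digit_def tj eq_nat_nat_iff)
  then have "int t dvd (int (n div t) * a + int j) - (int (n div t) * a + int j')"
    by (rule mod_eq_dvd_iff[THEN iffD1])
  then have "int t dvd int j - int j'" by simp
  then show "\<sigma> = \<tau>" using eq_if_dvd_diff_of_bounds[of t j j'] b t tj by simp
qed

text \<open>For each t the map \<open>read_digit\<close> translates j modulo t, so it permutes the
  states. Summing over all of them makes the bound independent of the partial quotient a.\<close>

lemma sum_read_digit_le:
  assumes "0 < n"
  shows "(\<Sum>\<sigma>\<in>states n. euc_odd (euc (snd (read_digit n a \<sigma>)) (fst (read_digit n a \<sigma>)))) \<le> state_sum n"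
proof -
  have "(\<Sum>\<sigma>\<in>states n. euc_odd (euc (snd (read_digit n a \<sigma>)) (fst (read_digit n a \<sigma>))))
    = (\<Sum>(t, j)\<in>read_digit n a ` states n. euc_odd (euc j t))"
    by (simp add: sum.reindex[OF read_digit_inj_on[OF assms]] case_prod_unfold)
  also have "\<dots> \<le> state_sum n"
    unfolding state_sum_def using read_digit_in_states[OF _ assms] finite_states[OF assms]
    by (intro sum_mono2) auto
  finally show ?thesis .
qed

text \<open>Moves the matrix past the preperiod of x. Each partial quotient contributes a factor of
  determinant -1, so the determinant is kept up to sign.\<close>

lemma moebius_cf_rem:
  fixes s X t Y :: int
  assumes x: "x \<notin> \<rat>" and det: "s * Y - X * t \<noteq> 0" and prim: "primitive_lat (rowlat s X t Y)"
  shows "\<exists>s' X' t' Y'. \<bar>s' * Y' - X' * t'\<bar> = \<bar>s * Y - X * t\<bar> \<and> primitive_lat (rowlat s' X' t' Y') \<and>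
    (of_int s * x + of_int X) / (of_int t * x + of_int Y) =
    (of_int s' * cf_rem x l + of_int X') / (of_int t' * cf_rem x l + of_int Y')"
proof (induction l)
  case 0
  then show ?case using prim by auto
next
  case (Suc l)
  then obtain s' X' t' Y' where IH: "\<bar>s' * Y' - X' * t'\<bar> = \<bar>s * Y - X * t\<bar>"
    "primitive_lat (rowlat s' X' t' Y')"
    "(of_int s * x + of_int X) / (of_int t * x + of_int Y) =
     (of_int s' * cf_rem x l + of_int X') / (of_int t' * cf_rem x l + of_int Y')" by blast
  define a where "a = cf_term x l"
  define y where "y = cf_rem x (Suc l)"
  have y: "y \<noteq> 0" using cf_rem_Suc_gt_1[OF x, of l] by (simp add: y_def del: cf_rem.simps)
  have rem: "cf_rem x l = of_int a + 1 / y"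
    using cf_rem_step[OF x, of l] by (simp only: a_def y_def)
  have *: "of_int p * cf_rem x l + of_int q = (of_int (a * p + q) * y + of_int p) / y" for p q
    using y by (simp add: rem field_simps)
  have "(of_int s' * cf_rem x l + of_int X') / (of_int t' * cf_rem x l + of_int Y') =
    (of_int (a * s' + X') * y + of_int s') / (of_int (a * t' + Y') * y + of_int t')"
    unfolding * using y by simp
  moreover have "primitive_lat (rowlat (a * s' + X') s' (a * t' + Y') t')"
    using primitive_lat_digit_map[OF IH(2)] by (simp add: digit_map_rowlat)
  moreover have "\<bar>(a * s' + X') * t' - s' * (a * t' + Y')\<bar> = \<bar>s' * Y' - X' * t'\<bar>"
    by (simp add: algebra_simps abs_minus_commute)
  ultimately show ?case unfolding y_def[symmetric] IH(1)[symmetric] IH(3)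
    by - (rule exI[of _ "a * s' + X'"], rule exI[of _ s'], rule exI[of _ "a * t' + Y'"], rule exI[of _ t'],
      intro conjI)
qed

section \<open>Closed walks over the states\<close>

lemma periodic_add_mult:
  fixes f :: "nat \<Rightarrow> 'a"
  assumes "\<And>k. f (k + K) = f k"
  shows "f (k + i * K) = f k"
proof (induction i)
  case (Suc i)
  have "k + Suc i * K = (k + i * K) + K" by simp
  then show ?case using Suc assms[of "k + i * K"] by (simp only:)
qed simp

text \<open>
  Each partial quotient acts injectively on the states, so at a fixed position of the period the
  states met before the first return to the initial one are pairwise distinct. This is why every
  position contributes at most one full sum over all states.
\<close>
lemma injective_walk_sum_le:
  fixes \<sigma> :: "nat \<Rightarrow> 'a" and f :: "nat \<Rightarrow> 'a \<Rightarrow> nat"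
  assumes K: "0 < K" and S: "finite S" "\<And>k. \<sigma> k \<in> S"
    and cancel: "\<And>i j. \<sigma> (Suc i) = \<sigma> (Suc j) \<Longrightarrow> i mod K = j mod K \<Longrightarrow> \<sigma> i = \<sigma> j"
    and f: "\<And>k. f (k + K) = f k" and sum_f: "\<And>k. sum (f k) S \<le> C"
  shows "\<exists>r>0. \<sigma> (r * K) = \<sigma> 0 \<and> (\<Sum>k<r * K. f k (\<sigma> k)) \<le> K * C"
proof -
  \<comment> \<open>The indices m and m + d K have the same position in the period, so the same
    injective map led to both states and the walk can be traced back step by step.\<close>
  have cancel_many: "\<sigma> (d * K) = \<sigma> 0" if "\<sigma> (m + d * K) = \<sigma> m" for m d
    using that
  proof (induction m)
    case (Suc m)
    then show ?case using cancel[of "m + d * K" m] by simp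
  qed simp
  have fK: "f (i * K + p) = f p" for i p
    using periodic_add_mult[of f K, OF f, of p i] by (simp add: add.commute)
  have "\<not> inj_on (\<lambda>i. \<sigma> (i * K)) UNIV"
    using S finite_subset[of "range (\<lambda>i. \<sigma> (i * K))" S] finite_imageD[of "\<lambda>i. \<sigma> (i * K)" UNIV] by auto
  then obtain i j where ij: "i < j" "\<sigma> (i * K) = \<sigma> (j * K)"
    unfolding inj_on_def by (metis linorder_neqE_nat)
  have "i * K + (j - i) * K = j * K" using ij by (simp flip: add_mult_distrib)
  then have "\<sigma> ((j - i) * K) = \<sigma> 0" using cancel_many[of "i * K" "j - i"] ij by simp
  then have ex: "\<exists>r. 0 < r \<and> \<sigma> (r * K) = \<sigma> 0" using ij by (intro exI[of _ "j - i"]) auto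
  define r where "r = (LEAST r. 0 < r \<and> \<sigma> (r * K) = \<sigma> 0)"
  have r: "0 < r" "\<sigma> (r * K) = \<sigma> 0" using LeastI_ex[OF ex] by (auto simp: r_def)
  have r_least: "\<not> (0 < d \<and> \<sigma> (d * K) = \<sigma> 0)" if "d < r" for d
    using that not_less_Least unfolding r_def by blast
  have inj: "inj_on (\<lambda>i. \<sigma> (i * K + p)) {..<r}" for p
  proof -
    have "\<sigma> (i * K + p) \<noteq> \<sigma> (j * K + p)" if ij: "i < j" "j < r" for i j
    proof
      assume eq: "\<sigma> (i * K + p) = \<sigma> (j * K + p)"
      have "i * K + (j - i) * K = j * K" using ij by (simp flip: add_mult_distrib)
      then have "(i * K + p) + (j - i) * K = j * K + p" by linarith
      then have "\<sigma> ((i * K + p) + (j - i) * K) = \<sigma> (i * K + p)" by (simp only: eq)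
      then have "\<sigma> ((j - i) * K) = \<sigma> 0" by (rule cancel_many)
      then show False using r_least[of "j - i"] ij by (simp add: less_imp_diff_less)
    qed
    then show ?thesis unfolding inj_on_def by (metis lessThan_iff linorder_neqE_nat)
  qed
  have "(\<Sum>k<r * K. f k (\<sigma> k)) = (\<Sum>i<r. \<Sum>k\<in>{i * K..<i * K + K}. f k (\<sigma> k))"
    by (rule sum.nat_group[symmetric])
  also have "\<dots> = (\<Sum>i<r. \<Sum>p<K. f p (\<sigma> (i * K + p)))"
    by (simp add: sum.atLeastLessThan_shift_0[of _ "_ * K"] fK lessThan_atLeast0)
  also have "\<dots> = (\<Sum>p<K. \<Sum>i<r. f p (\<sigma> (i * K + p)))"
    by (rule sum.swap)
  also have "\<dots> \<le> (\<Sum>p<K. C)"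
  proof (rule sum_mono)
    fix p
    have "(\<Sum>i<r. f p (\<sigma> (i * K + p))) = sum (f p) ((\<lambda>i. \<sigma> (i * K + p)) ` {..<r})"
      by (simp add: sum.reindex[OF inj])
    also have "\<dots> \<le> sum (f p) S" using S by (intro sum_mono2) auto
    also have "\<dots> \<le> C" by (rule sum_f)
    finally show "(\<Sum>i<r. f p (\<sigma> (i * K + p))) \<le> C" .
  qed
  also have "\<dots> = K * C" by simp
  finally show ?thesis using r by blast
qed

lemma moebius_period:
  fixes s X t Y :: int and x :: real
  defines "h \<equiv> (of_int s * x + of_int X) / (of_int t * x + of_int Y)"
  assumes x: "x \<notin> \<rat>" and K: "0 < K" and per: "cf_rem x (l + K) = cf_rem x l"
    and n: "0 < n" "\<bar>s * Y - X * t\<bar> = int n" and prim: "primitive_lat (rowlat s X t Y)"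
  shows "\<exists>T>0. T \<le> K * state_sum n \<and> (\<exists>l. \<forall>i\<ge>l. cf_term h (i + T) = cf_term h i)"
proof -
  \<comment> \<open>From index \<open>Suc l\<close> on, every complete quotient exceeds 1, whereas x
    itself can be any irrational number.\<close>
  define y where "y k = cf_rem x (Suc l + k)" for k
  define a where "a k = cf_term x (Suc l + k)" for k
  have y: "y k \<notin> \<rat>" "1 < y k" for k
    using cf_rem_irrational[OF x] cf_rem_Suc_gt_1[OF x] by (auto simp: y_def simp del: cf_rem.simps)
  have y_step: "y k = of_int (a k) + 1 / y (Suc k)" for k
    using cf_rem_step[OF x, of "Suc l + k"] by (simp add: y_def a_def)
  have y_per: "y (k + K) = y k" for k
  proof -
    have i: "Suc l + (k + K) = (l + K) + Suc k" "Suc l + k = l + Suc k" by simp_all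
    show ?thesis unfolding y_def i cf_rem_add[of x "l + K"] cf_rem_add[of x l "Suc k"] per ..
  qed
  have a_eq: "a k = \<lfloor>y k\<rfloor>" for k by (simp add: a_def y_def cf_term_def)
  have a_per: "a (k + K) = a k" for k by (simp add: a_eq y_per)
  have a_mod: "a k = a (k mod K)" for k
    using periodic_add_mult[of a K, OF a_per, of "k mod K" "k div K"] by simp
  have det: "s * Y - X * t \<noteq> 0" using n by auto
  have h_irr: "h \<notin> \<rat>" unfolding h_def by (rule irrational_moebius(2)[OF x det])
  obtain s' X' t' Y' where M: "\<bar>s' * Y' - X' * t'\<bar> = int n" "primitive_lat (rowlat s' X' t' Y')"
    "h = (of_int s' * y 0 + of_int X') / (of_int t' * y 0 + of_int Y')"
    using moebius_cf_rem[OF x det prim, of "Suc l"] unfolding n(2) h_def y_def add_0_right by blast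
  have det': "s' * Y' - X' * t' \<noteq> 0" using M(1) n by auto
  from moebius_tail_rel_triangular[OF y(1)[of 0] det']
  obtain A B D \<delta>0 \<rho>0 where tri: "0 < A" "0 < D" "A * D = int n" "rowlat s' X' t' Y' = rowlat A B 0 D"
    "0 < \<rho>0" "tail_rel h ((of_int A * y 0 + of_int B) / of_int D) \<delta>0 \<rho>0"
    unfolding M(1) M(3)[symmetric] by blast
  obtain \<sigma>0 where \<sigma>0: "\<sigma>0 \<in> states n"
    "tail_rel ((of_int A * y 0 + of_int B) / of_int D) (state_val n \<sigma>0 (y 0)) 0 1"
    using triangular_to_state[OF tri(1-3)] M(2) tri(4) by metis
  have h_rel: "tail_rel h (state_val n \<sigma>0 (y 0)) \<delta>0 \<rho>0"
    using tail_rel_trans[OF tri(6) \<sigma>0(2)] by simp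

  define cost where "cost k \<sigma> = euc_odd (euc (snd (read_digit n (a k) \<sigma>)) (fst (read_digit n (a k) \<sigma>)))"
    for k \<sigma>
  have "\<exists>\<sigma>. \<sigma> 0 = \<sigma>0 \<and> (\<forall>k. \<sigma> k \<in> states n \<and>
      state_lat n (\<sigma> (Suc k)) = digit_map (a k) ` state_lat n (\<sigma> k) \<and>
      (\<exists>\<delta>\<le>int (cost k (\<sigma> k)). tail_rel (state_val n (\<sigma> k) (y k)) (state_val n (\<sigma> (Suc k)) (y (Suc k)))
         \<delta> (y (Suc k) * of_nat (fst (\<sigma> k)) / of_nat (fst (\<sigma> (Suc k))))))"
  proof -
    define P where "P k \<sigma> \<longleftrightarrow> \<sigma> \<in> states n \<and> (k = 0 \<longrightarrow> \<sigma> = \<sigma>0)" for k :: nat and \<sigma>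
    define Q where "Q k \<sigma> \<tau> \<longleftrightarrow> state_lat n \<tau> = digit_map (a k) ` state_lat n \<sigma> \<and>
      (\<exists>\<delta>\<le>int (cost k \<sigma>). tail_rel (state_val n \<sigma> (y k)) (state_val n \<tau> (y (Suc k)))
         \<delta> (y (Suc k) * of_nat (fst \<sigma>) / of_nat (fst \<tau>)))" for k \<sigma> \<tau>
    have "\<exists>\<tau>. P (Suc k) \<tau> \<and> Q k \<sigma> \<tau>" if "P k \<sigma>" for k \<sigma>
    proof -
      have "0 < y (Suc k)" using y(2)[of "Suc k"] by simp
      from state_transition[OF _ n(1) y(1)[of "Suc k"] this, of \<sigma> "a k"] that
      show ?thesis unfolding P_def Q_def cost_def y_step[of k] by blast
    qed
    moreover have "\<exists>\<sigma>. P 0 \<sigma>" using \<sigma>0(1) by (intro exI[of _ \<sigma>0]) (simp add: P_def)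
    ultimately obtain \<sigma> where "\<And>k. P k (\<sigma> k)" "\<And>k. Q k (\<sigma> k) (\<sigma> (Suc k))"
      using dependent_nat_choice[of P Q] by blast
    then show ?thesis unfolding P_def Q_def by (intro exI[of _ \<sigma>]) blast
  qed
  then obtain \<sigma> \<delta> where \<sigma>: "\<sigma> 0 = \<sigma>0" "\<And>k. \<sigma> k \<in> states n"
      "\<And>k. state_lat n (\<sigma> (Suc k)) = digit_map (a k) ` state_lat n (\<sigma> k)"
    and \<delta>: "\<And>k. \<delta> k \<le> int (cost k (\<sigma> k))"
      "\<And>k. tail_rel (state_val n (\<sigma> k) (y k)) (state_val n (\<sigma> (Suc k)) (y (Suc k)))
         (\<delta> k) (y (Suc k) * of_nat (fst (\<sigma> k)) / of_nat (fst (\<sigma> (Suc k))))"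
    by metis
  have fst_pos: "0 < fst (\<sigma> k)" for k
    using states_bounds(1)[of "fst (\<sigma> k)" "snd (\<sigma> k)" n] \<sigma>(2) n by simp
  \<comment> \<open>The ratios of the state entries telescope. On a closed walk they cancel and
    leave the product of the complete quotients.\<close>
  have chain: "tail_rel (state_val n (\<sigma> 0) (y 0)) (state_val n (\<sigma> k) (y k)) (\<Sum>i<k. \<delta> i)
      ((\<Prod>i<k. y (Suc i)) * of_nat (fst (\<sigma> 0)) / of_nat (fst (\<sigma> k)))" for k
  proof (induction k)
    case 0
    then show ?case using tail_rel_refl fst_pos[of 0] by simp
  next
    case (Suc k)
    from tail_rel_trans[OF Suc \<delta>(2)[of k]] show ?case using fst_pos[of k] by (simp add: mult_ac)
  qed
  have "\<exists>r>0. \<sigma> (r * K) = \<sigma> 0 \<and> (\<Sum>k<r * K. cost k (\<sigma> k)) \<le> K * state_sum n"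
  proof (rule injective_walk_sum_le[OF K finite_states[OF n(1)] \<sigma>(2)])
    fix i j assume eq: "\<sigma> (Suc i) = \<sigma> (Suc j)" "i mod K = j mod K"
    then have "a i = a j" using a_mod by metis
    then have "digit_map (a i) ` state_lat n (\<sigma> i) = digit_map (a i) ` state_lat n (\<sigma> j)"
      using \<sigma>(3) eq by metis
    then have "state_lat n (\<sigma> i) = state_lat n (\<sigma> j)"
      using inj_image_eq_iff[OF inj_digit_map] by blast
    then show "\<sigma> i = \<sigma> j" using state_lat_inj \<sigma>(2) n by blast
  next
    show "cost (k + K) = cost k" for k by (simp add: cost_def a_per fun_eq_iff)
    show "sum (cost k) (states n) \<le> state_sum n" for k
      unfolding cost_def by (rule sum_read_digit_le[OF n(1)])
  qed
  then obtain r where r: "0 < r" "\<sigma> (r * K) = \<sigma> 0" "(\<Sum>k<r * K. cost k (\<sigma> k)) \<le> K * state_sum n"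
    by blast
  define T where "T = (\<Sum>i<r * K. \<delta> i)"
  define \<rho> where "\<rho> = (\<Prod>i<r * K. y (Suc i))"
  have "y (r * K) = y 0"
    using periodic_add_mult[of y K, OF y_per, of 0 r] by simp
  then have "tail_rel (state_val n \<sigma>0 (y 0)) (state_val n \<sigma>0 (y 0)) T \<rho>"
    using chain[of "r * K"] r(2) fst_pos[of 0] by (simp add: T_def \<rho>_def \<sigma>(1))
  \<comment> \<open>Going from h to the initial state, around the walk and back to h cancels
    \<delta>0 and \<rho>0.\<close>
  from tail_rel_trans[OF h_rel tail_rel_trans[OF this tail_rel_sym[OF h_rel]]]
  have "tail_rel h h T \<rho>" using tri(5) by simp
  moreover have "1 < \<rho>"
    unfolding \<rho>_def using y(2) r(1) K by (intro less_1_prod) (auto simp: lessThan_empty_iff)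
  ultimately have T: "0 < T" "\<exists>l. \<forall>i\<ge>l. cf_term h (i + nat T) = cf_term h i"
    using tail_rel_self_imp_period[OF h_irr] by blast+
  have "T \<le> (\<Sum>k<r * K. int (cost k (\<sigma> k)))" unfolding T_def using \<delta>(1) by (intro sum_mono)
  also have "\<dots> \<le> int (K * state_sum n)" using r(3) by (metis of_nat_le_iff of_nat_sum)
  finally have "nat T \<le> K * state_sum n" by (simp only: nat_le_iff)
  then show ?thesis using T by (intro exI[of _ "nat T"]) auto
qed

section \<open>Lagrange's theorem\<close>

text \<open>One step of a common expansion multiplies the distance of u and v by the product of the
  next quotients. Two steps at least double it, because u' u'' = a' u'' + 1 is at least 2 for
  successive quotients u' and u'', so a bounded distance must be 0.\<close>

lemma cf_separation:
  fixes a u v :: "nat \<Rightarrow> real"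
  assumes u: "\<And>i. u i = a i + 1 / u (Suc i)" "\<And>i. 1 < u i"
    and v: "\<And>i. v i = a i + 1 / v (Suc i)" "\<And>i. 1 < v i"
    and a: "\<And>i. 1 \<le> a i" and close: "\<And>i. \<bar>u i - v i\<bar> < 1"
  shows "u 0 = v 0"
proof (rule ccontr)
  assume "u 0 \<noteq> v 0"
  define e where "e i = \<bar>u i - v i\<bar>" for i
  have step: "e (Suc i) = u (Suc i) * v (Suc i) * e i" for i
  proof -
    have pos: "0 < u (Suc i)" "0 < v (Suc i)" using u(2)[of "Suc i"] v(2)[of "Suc i"] by auto
    have "u i - v i = 1 / u (Suc i) - 1 / v (Suc i)"
      using u(1)[of i] v(1)[of i] by linarith
    also have "\<dots> = (v (Suc i) - u (Suc i)) / (u (Suc i) * v (Suc i))"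
      using pos by (simp add: field_simps)
    finally have "u i - v i = (v (Suc i) - u (Suc i)) / (u (Suc i) * v (Suc i))" .
    then show ?thesis using pos by (simp add: e_def abs_divide abs_mult abs_minus_commute)
  qed
  have two: "e (Suc (Suc i)) \<ge> 2 * e i" for i
  proof -
    have "u (Suc i) * u (Suc (Suc i)) = a (Suc i) * u (Suc (Suc i)) + 1"
      using u(1)[of "Suc i"] u(2)[of "Suc (Suc i)"] by (simp add: field_simps)
    moreover have "1 * 1 \<le> a (Suc i) * u (Suc (Suc i))"
      using a[of "Suc i"] u(2)[of "Suc (Suc i)"] by (intro mult_mono) auto
    ultimately have 1: "2 \<le> u (Suc i) * u (Suc (Suc i))" by simp
    have 2: "1 * 1 \<le> v (Suc i) * v (Suc (Suc i))"
      using v(2)[of "Suc i"] v(2)[of "Suc (Suc i)"] by (intro mult_mono) auto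
    have "2 * 1 \<le> (u (Suc i) * u (Suc (Suc i))) * (v (Suc i) * v (Suc (Suc i)))"
      using 1 2 by (intro mult_mono) auto
    then have "2 * 1 * e i \<le> (u (Suc i) * u (Suc (Suc i))) * (v (Suc i) * v (Suc (Suc i))) * e i"
      by (intro mult_right_mono) (auto simp: e_def)
    then show ?thesis by (simp add: step mult_ac)
  qed
  have pow: "2 ^ i * e 0 \<le> e (2 * i)" for i
  proof (induction i)
    case (Suc i)
    then show ?case using two[of "2 * i"] by simp
  qed simp
  have e0: "0 < e 0" using \<open>u 0 \<noteq> v 0\<close> by (simp add: e_def)
  obtain i where "1 / e 0 < 2 ^ i" using real_arch_pow[of 2 "1 / e 0"] by auto
  then have "1 < 2 ^ i * e 0" using e0 by (simp add: field_simps)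
  then show False using pow[of i] close[of "2 * i"] by (simp add: e_def)
qed

lemma cf_term_Suc_ge_1:
  assumes "x \<notin> \<rat>"
  shows "1 \<le> cf_term x (Suc i)"
  using cf_rem_Suc_gt_1[OF assms, of i] by (simp add: cf_term_def le_floor_iff del: cf_rem.simps)

definition cf_periodic :: "real \<Rightarrow> nat \<Rightarrow> bool" where
  "cf_periodic x k \<longleftrightarrow> k > 0 \<and> (\<exists>l. \<forall>i\<ge>l. cf_term x (i + k) = cf_term x i)"

text \<open>\<open>cf_per\<close> speaks of partial quotients, but a closed walk needs the complete
  quotients to recur. The two expansions that start a period apart have the same partial quotients
  and are identified by \<open>cf_separation\<close>.\<close>

lemma cf_periodic_imp_rem:
  assumes x: "x \<notin> \<rat>" and per: "cf_periodic x k"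
  shows "\<exists>l. cf_rem x (l + k) = cf_rem x l"
proof -
  obtain l where l: "\<And>i. i \<ge> l \<Longrightarrow> cf_term x (i + k) = cf_term x i"
    using per unfolding cf_periodic_def by blast
  define u v where "u i = cf_rem x (Suc l + i + k)" and "v i = cf_rem x (Suc l + i)" for i
  define a :: "nat \<Rightarrow> real" where "a i = of_int (cf_term x (Suc l + i))" for i
  have ta: "cf_term x (Suc l + i + k) = cf_term x (Suc l + i)" for i by (rule l) simp
  have "u 0 = v 0"
  proof (rule cf_separation[of u a v])
    fix i
    show "u i = a i + 1 / u (Suc i)"
      using cf_rem_step[OF x, of "Suc l + i + k"] unfolding u_def a_def ta[symmetric] by simp
    show "v i = a i + 1 / v (Suc i)"
      using cf_rem_step[OF x, of "Suc l + i"] unfolding v_def a_def by simp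
    show "1 < u i" "1 < v i" using cf_rem_Suc_gt_1[OF x] by (auto simp: u_def v_def simp del: cf_rem.simps)
    show "1 \<le> a i" using cf_term_Suc_ge_1[OF x, of "l + i"] by (simp add: a_def)
    have "\<lfloor>u i\<rfloor> = \<lfloor>v i\<rfloor>" using ta[of i] by (simp only: u_def v_def cf_term_def)
    then show "\<bar>u i - v i\<bar> < 1" by linarith
  qed
  then show ?thesis by (intro exI[of _ "Suc l"]) (simp add: u_def v_def)
qed

text \<open>
  Lagrange's theorem: the conjugates of the complete quotients are eventually negative, after
  which the quadratic forms that vanish at them have ac < 0 and fixed discriminant.
\<close>
lemma quadratic_irrational_cf_periodic:
  assumes "quadratic_irrational x"
  shows "\<exists>k. cf_periodic x k"
proof -
  obtain p0 q0 r0 :: int where x: "x \<notin> \<rat>" and p0: "p0 \<noteq> 0"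
    and root: "of_int p0 * x\<^sup>2 + of_int q0 * x + of_int r0 = 0"
    using assms unfolding quadratic_irrational_def by blast
  define a where "a i = cf_term x i" for i
  define u where "u i = cf_rem x i" for i
  \<comment> \<open>The conjugates of the complete quotients: the other root by Vieta, followed by
    the same partial quotients as for x.\<close>
  define v where "v = rec_nat (- of_int q0 / of_int p0 - x) (\<lambda>i w. 1 / (w - of_int (a i)))"
  \<comment> \<open>Coefficients of the form p w^2 + q w + r under the substitution w = a + 1 / w',
    after clearing the denominator.\<close>
  define F where "F = rec_nat (p0, q0, r0)
    (\<lambda>i (p, q, r). (p * (a i)\<^sup>2 + q * a i + r, 2 * p * a i + q, p))"
  define p q r where "p i = fst (F i)" and "q i = fst (snd (F i))" and "r i = snd (snd (F i))" for i
  have u: "u i = of_int (a i) + 1 / u (Suc i)" for i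
    unfolding u_def a_def by (rule cf_rem_step[OF x])
  have u_irr: "u i \<notin> \<rat>" for i using cf_rem_irrational[OF x] by (simp add: u_def)
  have u_gt: "1 < u (Suc i)" for i using cf_rem_Suc_gt_1[OF x] by (simp only: u_def)
  have a_ge: "1 \<le> a (Suc i)" for i using cf_term_Suc_ge_1[OF x] by (simp only: a_def)
  have v0: "v 0 = - of_int q0 / of_int p0 - x" and v_Suc: "v (Suc i) = 1 / (v i - of_int (a i))" for i
    by (simp_all add: v_def)
  have F0: "p 0 = p0" "q 0 = q0" "r 0 = r0" by (simp_all add: F_def p_def q_def r_def)
  have FS: "p (Suc i) = p i * (a i)\<^sup>2 + q i * a i + r i" "q (Suc i) = 2 * p i * a i + q i" "r (Suc i) = p i" for i
    by (simp_all add: F_def p_def q_def r_def case_prod_unfold)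
  have v_irr: "v i \<notin> \<rat>" for i
  proof (induction i)
    case 0
    have "x = - of_int q0 / of_int p0 - v 0" by (simp add: v0)
    moreover have "- of_int q0 / of_int p0 - v 0 \<in> \<rat>" if "v 0 \<in> \<rat>" using that by (intro Rats_diff) auto
    ultimately show ?case using x by metis
  next
    case (Suc i)
    have "v i - of_int (a i) \<notin> \<rat>"
      using Suc Rats_add[of "v i - of_int (a i)" "of_int (a i)"] by auto
    then show ?case unfolding v_Suc by (rule irrational_inverse)
  qed
  have v: "v i = of_int (a i) + 1 / v (Suc i)" for i
    by (simp add: v_Suc)
  have u_nz: "u i \<noteq> 0" and v_nz: "v i \<noteq> 0" for i using u_irr[of i] v_irr[of i] by auto
  have vieta: "p i \<noteq> 0 \<and> of_int (p i) * (u i + v i) = - of_int (q i) \<and> of_int (p i) * (u i * v i) = of_int (r i)" for i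
  proof (induction i)
    case 0
    have 1: "of_int p0 * (x + v 0) = - of_int q0" using p0 by (simp add: v0)
    have "of_int p0 * (x * v 0) = x * (of_int p0 * (x + v 0)) - of_int p0 * x\<^sup>2"
      by (simp add: algebra_simps power2_eq_square)
    also have "\<dots> = of_int r0" using root unfolding 1 by (simp add: algebra_simps)
    finally show ?case using p0 1 by (simp add: F0 u_def)
  next
    case (Suc i)
    define P Q R A where "P = real_of_int (p i)" and "Q = real_of_int (q i)"
      and "R = real_of_int (r i)" and "A = real_of_int (a i)"
    have IH: "P \<noteq> 0" "Q = - (P * (u i + v i))" "R = P * (u i * v i)"
      using Suc by (auto simp: P_def Q_def R_def)
    have nz: "u (Suc i) \<noteq> 0" "v (Suc i) \<noteq> 0" by (rule u_nz v_nz)+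
    have uv: "u i - A = 1 / u (Suc i)" "v i - A = 1 / v (Suc i)"
      using u[of i] v[of i] by (simp_all add: A_def)
    have "real_of_int (p (Suc i)) = P * A\<^sup>2 + Q * A + R" by (simp add: FS P_def Q_def R_def A_def)
    also have "\<dots> = P * ((u i - A) * (v i - A))" unfolding IH by (simp add: algebra_simps power2_eq_square)
    also have "\<dots> = P / (u (Suc i) * v (Suc i))" unfolding uv by simp
    finally have p': "real_of_int (p (Suc i)) = P / (u (Suc i) * v (Suc i))" .
    have "real_of_int (p (Suc i)) \<noteq> 0" using p' IH(1) nz by simp
    moreover have "real_of_int (p (Suc i)) * (u (Suc i) * v (Suc i)) = real_of_int (r (Suc i))"
      using p' nz by (simp add: FS P_def)
    moreover have "real_of_int (p (Suc i)) * (u (Suc i) + v (Suc i)) = P * ((u i - A) + (v i - A))"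
      unfolding uv p' using nz by (simp add: field_simps)
    moreover have "\<dots> = - real_of_int (q (Suc i))"
      using IH(2) by (simp add: FS P_def Q_def A_def algebra_simps)
    ultimately show ?case by simp
  qed
  define \<Delta> where "\<Delta> = q0\<^sup>2 - 4 * p0 * r0"
  have disc: "(q i)\<^sup>2 - 4 * p i * r i = \<Delta>" for i
  proof (induction i)
    case (Suc i)
    have "(q (Suc i))\<^sup>2 - 4 * p (Suc i) * r (Suc i) = (q i)\<^sup>2 - 4 * p i * r i"
      unfolding FS by (simp add: algebra_simps power2_eq_square)
    then show ?case using Suc by simp
  qed (simp add: F0 \<Delta>_def)
  have uv: "u i \<noteq> v i" for i
  proof
    assume "u i = v i"
    then have "u i = - of_int (q i) / (2 * of_int (p i))"
      using vieta[of i] by (simp add: field_simps)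
    then have "u i \<in> \<rat>" by (simp only:) (intro Rats_divide Rats_mult Rats_minus_iff[THEN iffD2]; simp)
    then show False using u_irr by blast
  qed
  \<comment> \<open>Otherwise all these conjugates would exceed 1, and u and v would have the same
    expansion, against \<open>cf_separation\<close>.\<close>
  have "\<exists>m. v (Suc m) < 0"
  proof (rule ccontr)
    assume "\<nexists>m. v (Suc m) < 0"
    then have pos: "0 < v (Suc i)" for i using v_nz[of "Suc i"] by (meson linorder_neqE_linordered_idom)
    have gt: "real_of_int (a (Suc i)) < v (Suc i)" for i using pos[of "Suc i"] v[of "Suc i"] by simp
    have v_gt: "1 < v (Suc i)" for i
    proof -
      have "1 \<le> real_of_int (a (Suc i))" using a_ge[of i] by simp
      then show ?thesis using gt[of i] by linarith
    qed
    have inv: "0 < 1 / w" "1 / w < 1" if "1 < w" for w :: real using that by auto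
    have "u (Suc 0) = v (Suc 0)"
    proof (rule cf_separation[of "\<lambda>i. u (Suc i)" "\<lambda>i. of_int (a (Suc i))" "\<lambda>i. v (Suc i)"])
      fix i
      show "\<bar>u (Suc i) - v (Suc i)\<bar> < 1"
        using u[of "Suc i"] v[of "Suc i"] inv[OF u_gt[of "Suc i"]] inv[OF v_gt[of "Suc i"]] by linarith
      show "1 \<le> real_of_int (a (Suc i))" using a_ge[of i] by simp
    qed (rule u v u_gt v_gt)+
    then show False using uv by blast
  qed
  then obtain m where m: "v (Suc m) < 0" by blast
  have neg: "v (Suc m + i) < 0" for i
  proof (induction i)
    case (Suc i)
    have "0 < real_of_int (a (Suc m + i))" using a_ge[of "m + i"] by simp
    then have "v (Suc m + i) - of_int (a (Suc m + i)) < 0" using Suc by linarith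
    then show ?case using v_Suc[of "Suc m + i"] by (simp add: divide_neg_neg divide_pos_neg)
  qed (use m in simp)
  have bnd: "F (Suc m + i) \<in> {- \<Delta>..\<Delta>} \<times> {- \<Delta>..\<Delta>} \<times> {- \<Delta>..\<Delta>}" for i
  proof -
    define k where "k = Suc m + i"
    have "u k * v k < 0" using neg[of i] u_gt[of "m + i"] by (simp add: k_def mult_pos_neg)
    moreover have "0 < (real_of_int (p k))\<^sup>2" using vieta[of k] by simp
    ultimately have "(real_of_int (p k))\<^sup>2 * (u k * v k) < 0" by (rule mult_pos_neg[rotated])
    moreover have "(real_of_int (p k))\<^sup>2 * (u k * v k) = real_of_int (p k * r k)"
      using vieta[of k] by (simp add: power2_eq_square mult.assoc)
    ultimately have "real_of_int (p k * r k) < 0" by simp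
    then have pr: "p k * r k < 0" by (simp only: of_int_less_0_iff)
    then have nz: "p k \<noteq> 0" "r k \<noteq> 0" by auto
    have abs: "\<bar>p k\<bar> * \<bar>r k\<bar> = - (p k * r k)" using pr by (simp flip: abs_mult)
    have "1 * \<bar>r k\<bar> \<le> \<bar>p k\<bar> * \<bar>r k\<bar>" "\<bar>p k\<bar> * 1 \<le> \<bar>p k\<bar> * \<bar>r k\<bar>"
      using nz by (intro mult_right_mono mult_left_mono; simp)+
    moreover have "0 \<le> (q k)\<^sup>2" by simp
    moreover have "\<bar>q k\<bar> \<le> (q k)\<^sup>2"
    proof (cases "q k = 0")
      case False
      then have "\<bar>q k\<bar> * 1 \<le> \<bar>q k\<bar> * \<bar>q k\<bar>" by (intro mult_left_mono) auto
      then show ?thesis by (simp add: power2_eq_square)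
    qed simp
    moreover have "(q k)\<^sup>2 - 4 * (p k * r k) = \<Delta>" using disc[of k] by (simp add: mult.assoc)
    ultimately have "\<bar>p k\<bar> \<le> \<Delta>" "\<bar>q k\<bar> \<le> \<Delta>" "\<bar>r k\<bar> \<le> \<Delta>" using abs pr by linarith+
    moreover have "F k = (p k, q k, r k)" by (simp add: p_def q_def r_def)
    ultimately show ?thesis unfolding k_def[symmetric] by (auto simp: abs_le_iff)
  qed
  have "\<not> inj (\<lambda>i. F (Suc m + i))"
  proof
    assume "inj (\<lambda>i. F (Suc m + i))"
    moreover have "finite (range (\<lambda>i. F (Suc m + i)))"
      by (rule finite_subset[of _ "{- \<Delta>..\<Delta>} \<times> {- \<Delta>..\<Delta>} \<times> {- \<Delta>..\<Delta>}"])
        (use bnd in blast, simp)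
    ultimately show False using finite_imageD by blast
  qed
  then obtain i j where ij: "i < j" "F (Suc m + i) = F (Suc m + j)"
    unfolding inj_def by (metis linorder_neqE_nat)
  define k k' where "k = Suc m + i" and "k' = Suc m + j"
  have same: "p k' = p k" "q k' = q k" "r k' = r k" using ij(2) by (simp_all add: p_def q_def r_def k_def k'_def)
  have fac: "real_of_int (p k) * ((w - u k) * (w - v k)) =
    of_int (p k) * w\<^sup>2 + of_int (q k) * w + of_int (r k)" for k w
  proof -
    have "real_of_int (p k) * ((w - u k) * (w - v k)) =
      of_int (p k) * w\<^sup>2 - of_int (p k) * (u k + v k) * w + of_int (p k) * (u k * v k)"
      by (simp add: algebra_simps power2_eq_square)
    then show ?thesis using vieta[of k] by simp
  qed
  \<comment> \<open>Equal forms have equal roots, and as u is positive and v negative from here on,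
    the two complete quotients must be the same root.\<close>
  have "real_of_int (p k) * ((u k' - u k) * (u k' - v k)) = 0"
    using fac[of k "u k'"] fac[of k' "u k'"] same by simp
  moreover have "u k' - v k > 0" using neg[of i] u_gt[of "m + j"] by (simp add: k_def k'_def)
  ultimately have eq: "u k' = u k" using vieta[of k] by simp
  have "cf_term x (l + (j - i)) = cf_term x l" if "l \<ge> k" for l
  proof -
    have "l + (j - i) = k' + (l - k)" "l = k + (l - k)" using that ij by (simp_all add: k_def k'_def)
    then show ?thesis unfolding cf_term_def using eq cf_rem_add[of x] unfolding u_def by metis
  qed
  then show ?thesis unfolding cf_periodic_def using ij by (intro exI[of _ "j - i"]) auto
qed

section \<open>Comparison with the constant\<close>

lemma euc_mult:
  assumes "0 < p"
  shows "euc (p * a) (p * c) = euc a c"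
proof (induction a c rule: euc.induct)
  case (1 a c)
  show ?case
  proof (cases "c = 0")
    case False
    then show ?thesis using 1 assms
      by (subst euc.simps, subst (2) euc.simps) (simp add: mult_mod_right[symmetric])
  qed (simp add: euc.simps)
qed

text \<open>States of m are embedded into those of p m at equal cost. Keeping (t, j) multiplies m /
  t by p, which can spoil primitivity only if p divides t but not m / t. In that case (p t, p j) is
  used, with the same Euclidean algorithm; since p t does not divide m, the two kinds of images do
  not collide.\<close>

lemma state_sum_le_prime_mult:
  assumes p: "prime p" and m: "0 < m"
  shows "state_sum m \<le> state_sum (p * m)"
proof -
  define \<phi> where "\<phi> = (\<lambda>(t, j). if p dvd t \<and> \<not> p dvd m div t then (p * t, p * j) else (t, j))"
  have p0: "0 < p" using p prime_gt_0_nat by blast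
  have inj: "inj_on \<phi> (states m)"
  proof (rule inj_onI)
    fix \<sigma> \<tau> assume st: "\<sigma> \<in> states m" "\<tau> \<in> states m" and eq: "\<phi> \<sigma> = \<phi> \<tau>"
    obtain t j t' j' where tj: "\<sigma> = (t, j)" "\<tau> = (t', j')" by (metis surj_pair)
    note b = states_bounds[OF st(1)[unfolded tj] m] states_bounds[OF st(2)[unfolded tj] m]
    have no: "\<not> p * t dvd m" if "\<not> p dvd m div t" "t dvd m" "0 < t" for t
      using that by (metis dvd_div_iff_mult less_not_refl)
    show "\<sigma> = \<tau>" using eq p0 no[of t] no[of t'] b unfolding tj \<phi>_def by (auto split: if_splits)
  qed
  have into: "\<phi> \<sigma> \<in> states (p * m)" if "\<sigma> \<in> states m" for \<sigma>
  proof -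
    obtain t j where tj: "\<sigma> = (t, j)" by (metis surj_pair)
    note b = states_bounds[OF that[unfolded tj] m]
    have g: "gcd (gcd t (m div t)) j = 1" using that by (simp add: states_def tj)
    show ?thesis
    proof (cases "p dvd t \<and> \<not> p dvd m div t")
      case True
      then have "coprime p (m div t)" using p by (simp add: prime_imp_coprime)
      then have "gcd (p * t) (m div t) = gcd t (m div t)"
        by (metis coprime_commute gcd.commute gcd_mult_left_left_cancel)
      moreover have "coprime p (gcd t (m div t))"
        using \<open>coprime p (m div t)\<close> by (meson coprime_divisors dvd_refl gcd_dvd2)
      then have "gcd (gcd t (m div t)) (p * j) = gcd (gcd t (m div t)) j"
        by (metis coprime_commute gcd_mult_right_left_cancel)
      ultimately show ?thesis using True b g p0 by (simp add: \<phi>_def tj states_def)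
    next
      case False
      have div: "p * m div t = p * (m div t)" using b by (simp add: div_mult_swap)
      have "gcd (gcd t (p * (m div t))) j = 1"
      proof (rule ccontr)
        assume "gcd (gcd t (p * (m div t))) j \<noteq> 1"
        then obtain q where q: "prime q" "q dvd gcd (gcd t (p * (m div t))) j"
          using prime_factor_nat by blast
        then have qd: "q dvd t" "q dvd p * (m div t)" "q dvd j" by auto
        have "q dvd m div t"
        proof (cases "q dvd p")
          case True
          then have "q = p" using p q(1) by (simp add: primes_dvd_imp_eq)
          then show ?thesis using False qd by simp
        next
          case False
          then show ?thesis using qd(2) q(1) by (simp add: prime_dvd_mult_iff)
        qed
        then have "q dvd gcd (gcd t (m div t)) j" using qd by simp
        then show False using g q(1) by (simp only:) simp
      qed
      then have "(t, j) \<in> states (p * m)" using b div by (simp add: states_def)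
      then show ?thesis using False by (auto simp: \<phi>_def tj)
    qed
  qed
  have "state_sum m = (\<Sum>(t, j)\<in>\<phi> ` states m. euc_odd (euc j t))"
    unfolding state_sum_def sum.reindex[OF inj]
    by (intro sum.cong) (auto simp: \<phi>_def euc_mult[OF p0])
  also have "\<dots> \<le> state_sum (p * m)"
    unfolding state_sum_def using into finite_states[of "p * m"] p0 m by (intro sum_mono2) auto
  finally show ?thesis .
qed

lemma state_sum_le_mult:
  assumes "0 < k" "0 < m"
  shows "state_sum m \<le> state_sum (k * m)"
  using assms(1)
proof (induction k rule: less_induct)
  case (less k)
  show ?case
  proof (cases "k = 1")
    case False
    then obtain p where p: "prime p" "p dvd k" using prime_factor_nat by blast
    then obtain k' where k': "k = p * k'" by blast
    have "0 < k'" "k' < k" using less.prems k' prime_gt_1_nat[OF p(1)] by auto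
    then have "state_sum m \<le> state_sum (k' * m)" using less.IH by simp
    also have "\<dots> \<le> state_sum (p * (k' * m))"
      using \<open>0 < k'\<close> assms(2) by (intro state_sum_le_prime_mult[OF p(1)]) simp
    finally show ?thesis by (simp add: k' mult.assoc)
  qed simp
qed

lemma state_sum_le_S_const:
  assumes "0 < n"
  shows "state_sum n \<le> S_const n"
proof -
  define I where "I = (SIGMA t:{t. t dvd n}. {t..2 * t - 1} - J_set n t)"
  have fin: "finite {t. t dvd n}" using assms by simp
  have "S_const n = (\<Sum>(t, j)\<in>I. 2 * (xi j t div 2) + 1)"
    unfolding S_const_def I_def using fin by (intro sum.Sigma) auto
  also have "\<dots> = (\<Sum>(t, j)\<in>I. euc_odd (euc j t))"
    by (intro sum.cong) (auto simp: I_def xi_def euc_odd_def max_def min_def)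
  finally have S: "S_const n = (\<Sum>(t, j)\<in>I. euc_odd (euc j t))" .
  have "states n \<subseteq> I"
  proof
    fix \<sigma> assume st: "\<sigma> \<in> states n"
    obtain t j where tj: "\<sigma> = (t, j)" by (metis surj_pair)
    note b = states_bounds[OF st[unfolded tj] assms]
    have "j \<notin> J_set n t"
      using st by (auto simp: J_set_def states_def tj gcd.commute)
    then show "\<sigma> \<in> I" using b by (auto simp: I_def tj)
  qed
  then show ?thesis unfolding S state_sum_def using fin
    by (intro sum_mono2) (auto simp: I_def)
qed

section \<open>Period bounds\<close>

lemma cf_per_eq_Least: "cf_per x = (LEAST k. cf_periodic x k)"
  by (simp add: cf_per_def cf_periodic_def)

text \<open>Cancelling g leaves the transformation unchanged, and \<open>state_sum_le_mult\<close>
  absorbs the factor g^2 of the determinant. The first conclusion provides a period of the image, so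
  the lemma can be applied again to the image and the adjugate matrix.\<close>

lemma cf_per_moebius_le:
  fixes a b c d :: int
  assumes x: "x \<notin> \<rat>" and per: "cf_periodic x k" and det: "a * d - b * c \<noteq> 0"
  shows "\<exists>T. cf_periodic (moebius a b c d x) T"
    "cf_per (moebius a b c d x) \<le> cf_per x * S_const (nat \<bar>a * d - b * c\<bar>)"
proof -
  define h where "h = moebius a b c d x"
  define g where "g = gcd (gcd a b) (gcd c d)"
  have "g \<noteq> 0" using det by (auto simp: g_def)
  have "g dvd a" "g dvd b" "g dvd c" "g dvd d" unfolding g_def by (meson dvd_trans gcd_dvd1 gcd_dvd2)+
  then obtain a' b' c' d' where abcd: "a = g * a'" "b = g * b'" "c = g * c'" "d = g * d'"
    by (elim dvdE)
  define n where "n = nat \<bar>a' * d' - b' * c'\<bar>"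
  have det': "a * d - b * c = g\<^sup>2 * (a' * d' - b' * c')"
    by (simp add: abcd power2_eq_square algebra_simps)
  then have n: "0 < n" "\<bar>a' * d' - b' * c'\<bar> = int n" using det by (auto simp: n_def)
  have nn: "nat \<bar>a * d - b * c\<bar> = nat (g\<^sup>2) * n"
    by (simp add: det' abs_mult nat_mult_distrib n_def)
  have prim: "primitive_lat (rowlat a' b' c' d')"
    unfolding primitive_lat_rowlat_iff
  proof (intro allI impI)
    fix e assume "e dvd a' \<and> e dvd b' \<and> e dvd c' \<and> e dvd d'"
    then have "g * e dvd g" unfolding g_def by (metis abcd gcd_greatest g_def mult_dvd_mono dvd_refl)
    then show "is_unit e" using \<open>g \<noteq> 0\<close> by (metis dvd_mult_cancel_left mult.right_neutral)
  qed
  have h: "h = (of_int a' * x + of_int b') / (of_int c' * x + of_int d')"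
  proof -
    have "h = (of_int g * (of_int a' * x + of_int b')) / (of_int g * (of_int c' * x + of_int d'))"
      by (simp add: h_def moebius_def abcd algebra_simps)
    then show ?thesis using \<open>g \<noteq> 0\<close> by simp
  qed
  define K where "K = cf_per x"
  have K: "cf_periodic x K" unfolding K_def cf_per_eq_Least using per by (rule LeastI)
  obtain l where "cf_rem x (l + K) = cf_rem x l" using cf_periodic_imp_rem[OF x K] by blast
  from moebius_period[OF x _ this n prim, folded h] obtain T where
    T: "0 < T" "T \<le> K * state_sum n" "\<exists>l. \<forall>i\<ge>l. cf_term h (i + T) = cf_term h i"
    using K by (auto simp: cf_periodic_def)
  have hT: "cf_periodic h T" using T by (simp add: cf_periodic_def)
  then show "\<exists>T. cf_periodic (moebius a b c d x) T" unfolding h_def by blast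
  have "cf_per h \<le> T" unfolding cf_per_eq_Least using hT by (rule Least_le)
  also note T(2)
  also have "state_sum n \<le> state_sum (nat (g\<^sup>2) * n)"
    using \<open>g \<noteq> 0\<close> n by (intro state_sum_le_mult) auto
  also have "\<dots> \<le> S_const (nat \<bar>a * d - b * c\<bar>)"
    unfolding nn using \<open>g \<noteq> 0\<close> n by (intro state_sum_le_S_const) auto
  finally show "cf_per (moebius a b c d x) \<le> cf_per x * S_const (nat \<bar>a * d - b * c\<bar>)"
    by (simp add: h_def K_def)
qed

lemma moebius_adjugate:
  fixes a b c d :: int
  assumes x: "x \<notin> \<rat>" and det: "a * d - b * c \<noteq> 0"
  shows "moebius d (- b) (- c) a (moebius a b c d x) = x"
proof -
  define h where "h = moebius a b c d x"
  define D where "D = of_int c * x + of_int d"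
  have D: "D \<noteq> 0" using irrational_moebius(1)[OF x det] by (simp add: D_def)
  have h: "h = (of_int a * x + of_int b) / D" by (simp add: h_def moebius_def D_def)
  have \<Delta>: "real_of_int a * of_int d - of_int b * of_int c \<noteq> 0"
    using det by (metis of_int_diff of_int_eq_0_iff of_int_mult)
  have 1: "of_int d * h + of_int (- b) = x * (real_of_int a * of_int d - of_int b * of_int c) / D"
    unfolding h using D by (simp add: field_simps) (simp add: D_def algebra_simps)
  have 2: "of_int (- c) * h + of_int a = (real_of_int a * of_int d - of_int b * of_int c) / D"
    unfolding h using D by (simp add: field_simps) (simp add: D_def algebra_simps)
  show ?thesis unfolding h_def[symmetric] unfolding moebius_def 1 2 using D \<Delta> by simp
qed

theorem theorem1:
  fixes x :: real and a b c d :: int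
  assumes "quadratic_irrational x"
    and "a * d - b * c \<noteq> 0"
  defines "n \<equiv> nat \<bar>a * d - b * c\<bar>"
  shows "real (cf_per x) / real (S_const n) \<le> real (cf_per (moebius a b c d x))
       \<and> real (cf_per (moebius a b c d x)) \<le> real (S_const n) * real (cf_per x)"
proof -
  define h where "h = moebius a b c d x"
  have x: "x \<notin> \<rat>" using assms(1) by (simp add: quadratic_irrational_def)
  obtain k where k: "cf_periodic x k" using quadratic_irrational_cf_periodic[OF assms(1)] by blast
  have upper: "cf_per h \<le> cf_per x * S_const n"
    unfolding h_def n_def by (rule cf_per_moebius_le(2)[OF x k assms(2)])
  obtain T where T: "cf_periodic h T" using cf_per_moebius_le(1)[OF x k assms(2)] unfolding h_def by blast
  have h: "h \<notin> \<rat>" using irrational_moebius(2)[OF x assms(2)] by (simp add: h_def moebius_def)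
  have det: "d * a - - b * - c \<noteq> 0" using assms(2) by (simp add: mult.commute)
  have "cf_per (moebius d (- b) (- c) a h) \<le> cf_per h * S_const (nat \<bar>d * a - - b * - c\<bar>)"
    by (rule cf_per_moebius_le(2)[OF h T det])
  then have lower: "cf_per x \<le> cf_per h * S_const n"
    unfolding h_def moebius_adjugate[OF x assms(2)] n_def by (simp add: mult.commute)
  have "real (cf_per x) / real (S_const n) \<le> real (cf_per h)"
  \<comment> \<open>Division by 0 yields 0, which settles this case without a proof that the
    constant is positive.\<close>
  proof (cases "S_const n = 0")
    case False
    have "real (cf_per x) \<le> real (cf_per h) * real (S_const n)"
      using lower by (metis of_nat_le_iff of_nat_mult)
    then show ?thesis using False by (simp add: divide_le_eq)
  qed simp
  moreover have "real (cf_per h) \<le> real (S_const n) * real (cf_per x)"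
    using upper by (metis mult.commute of_nat_le_iff of_nat_mult)
  ultimately show ?thesis by (simp add: h_def)
qed

end
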